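(* Consider the Euler forward time discretization (E), described in the context, of the one-dimensional scheme with central and Lax–Friedrichs fluxes, with time step $\tau$, and let $l\in\{1,\dots,m\}$. 1. Suppose $\rho_{h,l}^n(x_i^r)\ge0$ for all $i$ and $r$. Take $$\tau\le\min_{i=1,\dots,N}\left(\left(\frac{w_1h_i}{\alpha+v_{h,l}^+}\right)_{i-\frac12},\ \left(\frac{w_{k+1}h_i}{\alpha-v_{h,l}^-}\right)_{i+\frac12}\right).$$ Then the preliminary solution $\rho_{h,l}^{n+1,\mathrm{pre}}$ obtained through the Euler forward time stepping (E) has non-negative cell averages $(\bar\rho_{h,l})_i^{n+1,\mathrm{pre}}$. 2. Let $$\theta_{l,i}=\min\left(\frac{(\bar\rho_{h,l})_i^{n+1,\mathrm{pre}}}{(\bar\rho_{h,l})_i^{n+1,\mathrm{pre}}-\rho^{\min}_{l,i}},1\right),\qquad \rho^{\min}_{l,i}=\min_r\left(\rho_{h,l}^{n+1,\mathrm{pre}}(x_i^r)\right),$$ and define $\rho_{h,l}^{n+1}\in V_h$ so that $$\rho_{h,l}^{n+1}(x_i^r)=(\bar\rho_{h,l})_i^{n+1,\mathrm{pre}}+\theta_{l,i}\left(\rho_{h,l}^{n+1,\mathrm{pre}}(x_i^r)-(\bar\rho_{h,l})_i^{n+1,\mathrm{pre}}\right).$$ Then $\rho_{h,l}^{n+1}(x_i^r)$ is non-negative. Furthermore, the interpolation polynomial $\rho_{h,l}^{n+1}(x)$ maintains spatial accuracy in the sense that, for $x\in I_i$, $$|(\rho_{h,l})_i^{n+1}(x)-(\rho_{h,l})_i^{n+1,\mathrm{pre}}(x)|\le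 C_k\max_{x\in I_i}|\rho_l(x,t_{n+1})-(\rho_{h,l})_i^{n+1,\mathrm{pre}}(x)|,$$ where $\rho_l$ is the $l$-th component of the exact (non-negative) solution, the subscript $i$ denotes the polynomial on $I_i$, and $C_k$ is a constant depending only on the polynomial degree $k$.
   Context: **Continuous problem.** On a bounded interval $\Omega\subset\mathbb R$ consider $\partial_t\boldsymbol\rho=\partial_x(F(\boldsymbol\rho)\partial_x\boldsymbol\xi(\boldsymbol\rho))$ for $\boldsymbol\rho=(\rho_1,\dots,\rho_m)^T$. Here $e=e(\boldsymbol\rho)$ is a scalar-valued twice differentiable convex function, $\boldsymbol\xi=(\partial_{\rho_1}e,\dots,\partial_{\rho_m}e)^T$, and $F(\boldsymbol\rho)$ is an $m\times m$ matrix, possibly non-symmetric, with $\boldsymbol z\cdot F\boldsymbol z\ge0$ for all $\boldsymbol z\in\mathbb R^m$. The exact solution is non-negative. The periodic boundary condition (or compact support, treated in the same way) is assumed: the endpoints $x_{\frac12}$ and $x_{N+\frac12}$ are identified. The matrix $\mathrm{diag}(\boldsymbol\rho)^{-1}F(\boldsymbol\rho)$ is assumed bounded; i.e. $F(\boldsymbol\rho)=\mathrm{diag}(\boldsymbol\rho)G(\boldsymbol\rho)$ with $G$ bounded, and $\mathrm{diag}(\boldsymbol\rho)^{-1}F(\boldsymbol\rho)$ is understood as $G(\boldsymbol\rho)$, also where components of $\boldsymbol\rho$ vanish. All quantities in the scheme are assumed well-defined. **Mesh and space.** $\Omega$ is partitioned into cells $I_i=(x_{i-\frac12},x_{i+\frac12})$,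 $i=1,\dots,N$, with $h_i=x_{i+\frac12}-x_{i-\frac12}$, $h=\max_i h_i$ and $h_i\ge c_{mesh}h$ for a fixed constant $c_{mesh}>0$. For $k\ge1$, $V_h=\{v_h: v_h|_{I_i}\in P^k(I_i)\ \forall i\}$ ($P^k$: polynomials of degree at most $k$; no continuity across interfaces), and $\boldsymbol V_h=\prod_{l=1}^m V_h$. At an interface, superscripts $-$ and $+$ denote left and right limits, $\{\boldsymbol v\}=\frac12(\boldsymbol v^++\boldsymbol v^-)$, $[\boldsymbol v]=\boldsymbol v^+-\boldsymbol v^-$. The cell average of a function on $I_i$ is denoted by a bar with subscript $i$. The second subscript $l$ denotes the $l$-th component. **Quadrature.** $\{x_i^r\}_{r=1}^{k+1}$ are the $k+1$ Gauss–Lobatto points on $I_i$ in increasing order (including both endpoints, where one-sided limits from inside $I_i$ are used), and $w_r$ are the corresponding weights on $[-1,1]$ (so $\sum_r w_r=2$). Set $$\widetilde{\int_{I_i}}\boldsymbol\varphi\cdot\boldsymbol\psi\,dx=\frac{h_i}{2}\sum_{r=1}^{k+1}w_r\,\boldsymbol\varphi(x_i^r)\cdot\boldsymbol\psi(x_i^r),\qquad \widetilde{\int_{I_i}}\boldsymbol\varphi\cdot\partial_x\boldsymbol\psi\,dx=\frac{h_i}{2}\sum_{r=1}^{k+1}w_r\,\boldsymbol\varphi(x_i^r)\cdot\partial_x(\mathcal I\boldsymbol\psi)(x_i^r),$$ where $\mathcal I$ is componentwise degree-$k$ interpolation at the Gauss–Lobatto points of $I_i$. **Euler forward scheme.** Given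 $\boldsymbol\rho_h^n\in\boldsymbol V_h$, put $F_h=F(\boldsymbol\rho_h^n)$, $\boldsymbol\xi_h=\boldsymbol\xi(\boldsymbol\rho_h^n)$, and let $\boldsymbol u_h\in\boldsymbol V_h$ satisfy, for all $\boldsymbol\psi_h\in\boldsymbol V_h$ and all $i$, $$\widetilde{\int_{I_i}}\boldsymbol u_h\cdot\boldsymbol\psi_h\,dx=-\widetilde{\int_{I_i}}\boldsymbol\xi_h\cdot\partial_x\boldsymbol\psi_h\,dx+(\widehat{\boldsymbol\xi}\cdot\boldsymbol\psi_h^-)_{i+\frac12}-(\widehat{\boldsymbol\xi}\cdot\boldsymbol\psi_h^+)_{i-\frac12}.$$ The preliminary solution $\boldsymbol\rho_h^{n+1,\mathrm{pre}}\in\boldsymbol V_h$ is defined by: for all $\boldsymbol\varphi_h\in\boldsymbol V_h$ and all $i$, $$\text{(E)}\quad\widetilde{\int_{I_i}}\frac{\boldsymbol\rho_h^{n+1,\mathrm{pre}}-\boldsymbol\rho_h^n}{\tau}\cdot\boldsymbol\varphi_h\,dx=-\widetilde{\int_{I_i}}F_h\boldsymbol u_h\cdot\partial_x\boldsymbol\varphi_h\,dx+(\widehat{F\boldsymbol u}\cdot\boldsymbol\varphi_h^-)_{i+\frac12}-(\widehat{F\boldsymbol u}\cdot\boldsymbol\varphi_h^+)_{i-\frac12}.$$ Central and Lax–Friedrichs fluxes at each interface: $\widehat{\boldsymbol\xi}=\{\boldsymbol\xi_h\}$, $\widehat{F\boldsymbol u}=\{F_h\boldsymbol u_h\}+\frac{\alpha}{2}[\boldsymbol\rho_h^n]=\{\mathrm{diag}(\boldsymbol\rho_h^n)\boldsymbol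 v_h\}+\frac{\alpha}{2}[\boldsymbol\rho_h^n]$, where $\boldsymbol v_h=\mathrm{diag}(\boldsymbol\rho_h^n)^{-1}F_h\boldsymbol u_h$, $\alpha=\max(|\boldsymbol v_h^+|_\infty,|\boldsymbol v_h^-|_\infty)$ and $|\cdot|_\infty$ is the $\ell^\infty$ norm on $\mathbb R^m$. **Conventions.** A quotient with zero denominator in the time step restriction is read as $+\infty$; if $(\bar\rho_{h,l})_i^{n+1,\mathrm{pre}}=\rho^{\min}_{l,i}$ then $\theta_{l,i}=1$. Part 2 refers to the preliminary solution of part 1 (under the hypotheses of part 1). *)

theory Defs
  imports "HOL-Analysis.Analysis"
begin

text \<open>
  Conventions.  The number m of components is a natural number, not a type, so that a constant can be
  required to be independent of it: \<open>\<real>\<^sup>m\<close> is \<open>{1..m} \<rightarrow>\<^sub>E UNIV\<close>, with topology \<open>powertop_real {1..m}\<close>,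
  and an m-by-m matrix is a function of two indices in \<open>{1..m}\<close>.  Cells are numbered \<open>1..N\<close>; the
  interface \<open>x\<^bsub>j+1/2\<^esub>\<close> has number j in \<open>0..N\<close>, and \<open>xf j\<close> is its position.  Cell i is the interval
  from \<open>xf (i - 1)\<close> to \<open>xf i\<close>.
\<close>

type_synonym rvec = "nat \<Rightarrow> real"
type_synonym mesh = "nat \<Rightarrow> real"
type_synonym rmat = "nat \<Rightarrow> nat \<Rightarrow> real"

abbreviation vspace :: "nat \<Rightarrow> rvec set" where
  "vspace m \<equiv> {1..m} \<rightarrow>\<^sub>E (UNIV :: real set)"

definition mat_vec :: "nat \<Rightarrow> rmat \<Rightarrow> rvec \<Rightarrow> rvec" where
  "mat_vec m A z = (\<lambda>l\<in>{1..m}. \<Sum>j=1..m. A l j * z j)"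

definition linf_norm :: "nat \<Rightarrow> rvec \<Rightarrow> real" where
  "linf_norm m z = Max ((\<lambda>l. \<bar>z l\<bar>) ` {1..m})"


section \<open>The continuous problem\<close>

text \<open>Total (Frechet) differentiability, with derivative given by the vector g.\<close>

definition differentiable_at_vec :: "nat \<Rightarrow> (rvec \<Rightarrow> real) \<Rightarrow> rvec \<Rightarrow> bool" where
  "differentiable_at_vec m f \<rho> \<longleftrightarrow>
     (\<exists>g :: rvec. ((\<lambda>\<sigma>. (f \<sigma> - f \<rho> - (\<Sum>l=1..m. g l * (\<sigma> l - \<rho> l))) / L2_set (\<lambda>l. \<sigma> l - \<rho> l) {1..m})
        \<longlongrightarrow> 0) (atin (powertop_real {1..m}) \<rho>))"

definition partial_deriv :: "(rvec \<Rightarrow> real) \<Rightarrow> nat \<Rightarrow> rvec \<Rightarrow> real" where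
  "partial_deriv f l \<rho> = deriv (\<lambda>t. f (\<rho>(l := t))) (\<rho> l)"

definition twice_differentiable_on_vec :: "nat \<Rightarrow> (rvec \<Rightarrow> real) \<Rightarrow> rvec set \<Rightarrow> bool" where
  "twice_differentiable_on_vec m f U \<longleftrightarrow>
     (\<forall>\<rho>\<in>U. differentiable_at_vec m f \<rho> \<and> (\<forall>l\<in>{1..m}. differentiable_at_vec m (partial_deriv f l) \<rho>))"

definition convex_on_vec :: "nat \<Rightarrow> rvec set \<Rightarrow> (rvec \<Rightarrow> real) \<Rightarrow> bool" where
  "convex_on_vec m U f \<longleftrightarrow>
     (\<forall>\<rho>\<in>U. \<forall>\<sigma>\<in>U. \<forall>t\<in>{0..1}.
        (\<lambda>l\<in>{1..m}. (1 - t) * \<rho> l + t * \<sigma> l) \<in> U \<and>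
        f (\<lambda>l\<in>{1..m}. (1 - t) * \<rho> l + t * \<sigma> l) \<le> (1 - t) * f \<rho> + t * f \<sigma>)"

definition entropy_var :: "nat \<Rightarrow> (rvec \<Rightarrow> real) \<Rightarrow> rvec \<Rightarrow> rvec" where
  "entropy_var m e \<rho> = (\<lambda>l\<in>{1..m}. partial_deriv e l \<rho>)"

text \<open>
  The open convex set U is the domain of the entropy e (all of \<open>\<real>\<^sup>m\<close>, or for example the open positive
  orthant when e is logarithmic), and S is the set of states at which the hypotheses on the mobility
  matrix F are made (mobilities such as \<open>diag(\<rho>)\<close> are positive semidefinite only for non-negative
  states).  \<open>U = S = \<real>\<^sup>m\<close> is allowed.  G is the bounded matrix written \<open>diag(\<rho>)\<^sup>-\<^sup>1 F(\<rho>)\<close>.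
\<close>

definition gradient_flow_data ::
    "nat \<Rightarrow> rvec set \<Rightarrow> rvec set \<Rightarrow> (rvec \<Rightarrow> real) \<Rightarrow> (rvec \<Rightarrow> rmat) \<Rightarrow> (rvec \<Rightarrow> rmat) \<Rightarrow> bool" where
  "gradient_flow_data m U S e F G \<longleftrightarrow>
     openin (powertop_real {1..m}) U \<and> S \<subseteq> U \<and>
     twice_differentiable_on_vec m e U \<and> convex_on_vec m U e \<and>
     (\<forall>\<rho>\<in>S. \<forall>z\<in>vspace m. 0 \<le> (\<Sum>l=1..m. z l * mat_vec m (F \<rho>) z l)) \<and>
     (\<forall>\<rho>\<in>S. \<forall>l\<in>{1..m}. \<forall>j\<in>{1..m}. F \<rho> l j = \<rho> l * G \<rho> l j) \<and>
     (\<exists>B. \<forall>\<rho>\<in>S. \<forall>l\<in>{1..m}. \<forall>j\<in>{1..m}. \<bar>G \<rho> l j\<bar> \<le> B)"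

text \<open>
  Classical solution on the time interval from 0 to T of the system with periodic boundary conditions
  on the interval from a to b, as a function on the whole line that is periodic with period \<open>b - a\<close>.
\<close>

definition periodic_solution ::
    "nat \<Rightarrow> rvec set \<Rightarrow> (rvec \<Rightarrow> real) \<Rightarrow> (rvec \<Rightarrow> rmat) \<Rightarrow> real \<Rightarrow> real \<Rightarrow> real
      \<Rightarrow> (real \<Rightarrow> real \<Rightarrow> rvec) \<Rightarrow> bool" where
  "periodic_solution m S e F a b T \<rho> \<longleftrightarrow>
     (\<forall>x. \<forall>t\<in>{0..T}. \<rho> x t \<in> S \<and> \<rho> (x + (b - a)) t = \<rho> x t) \<and>
     (\<forall>l\<in>{1..m}. continuous_on (UNIV \<times> {0..T}) (\<lambda>(x, t). \<rho> x t l)) \<and>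
     (\<forall>x. \<forall>t\<in>{0<..<T}. \<forall>l\<in>{1..m}.
        (\<lambda>y. entropy_var m e (\<rho> y t) l) differentiable (at x) \<and>
        (\<exists>d. ((\<lambda>s. \<rho> x s l) has_real_derivative d) (at t) \<and>
             ((\<lambda>y. mat_vec m (F (\<rho> y t)) (\<lambda>j\<in>{1..m}. deriv (\<lambda>z. entropy_var m e (\<rho> z t) j) y) l)
                has_real_derivative d) (at x)))"


section \<open>Gauss--Lobatto quadrature and interpolation\<close>

text \<open>Rodrigues' formula.\<close>

definition legendre :: "nat \<Rightarrow> real poly" where
  "legendre k = smult (1 / (2 ^ k * fact k)) ((pderiv ^^ k) ([:-1, 0, 1:] ^ k))"

text \<open>The \<open>k + 1\<close> Gauss--Lobatto points on \<open>[-1, 1]\<close>, numbered from 1: the zeros of \<open>(1 - z\<^sup>2) P\<^sub>k'(z)\<close>.\<close>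

definition gl_point :: "nat \<Rightarrow> nat \<Rightarrow> real" where
  "gl_point k r = sorted_list_of_set {z. poly ([:1, 0, -1:] * pderiv (legendre k)) z = 0} ! (r - 1)"

definition lagrange_basis :: "nat \<Rightarrow> (nat \<Rightarrow> real) \<Rightarrow> nat \<Rightarrow> real poly" where
  "lagrange_basis k z r = (\<Prod>s\<in>{1..k+1} - {r}. smult (1 / (z r - z s)) [:- z s, 1:])"

definition interpolant :: "nat \<Rightarrow> (nat \<Rightarrow> real) \<Rightarrow> (real \<Rightarrow> real) \<Rightarrow> real poly" where
  "interpolant k z f = (\<Sum>r=1..k+1. smult (f (z r)) (lagrange_basis k z r))"

definition gl_weight :: "nat \<Rightarrow> nat \<Rightarrow> real" where
  "gl_weight k r = integral {-1..1} (poly (lagrange_basis k (gl_point k) r))"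


section \<open>Mesh, discrete space and quadrature on cells\<close>

definition cell_size :: "mesh \<Rightarrow> nat \<Rightarrow> real" where
  "cell_size xf i = xf i - xf (i - 1)"

definition is_mesh :: "nat \<Rightarrow> mesh \<Rightarrow> real \<Rightarrow> bool" where
  "is_mesh N xf c_mesh \<longleftrightarrow>
     1 \<le> N \<and> (\<forall>i\<in>{1..N}. xf (i - 1) < xf i) \<and>
     0 < c_mesh \<and> (\<forall>i\<in>{1..N}. c_mesh * (MAX j\<in>{1..N}. cell_size xf j) \<le> cell_size xf i)"

definition gl_node :: "nat \<Rightarrow> mesh \<Rightarrow> nat \<Rightarrow> nat \<Rightarrow> real" where
  "gl_node k xf i r = (xf (i - 1) + xf i) / 2 + cell_size xf i / 2 * gl_point k r"

text \<open>
  Discontinuous piecewise polynomials are represented by one polynomial (in the physical variable x)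
  per cell, so that one-sided limits at an interface are values of the polynomial of the adjacent cell.
  In a vector-valued function the first index is the cell and the second the component.
\<close>

type_synonym dg = "nat \<Rightarrow> real poly"
type_synonym dg_vec = "nat \<Rightarrow> nat \<Rightarrow> real poly"

definition dg_space :: "nat \<Rightarrow> nat \<Rightarrow> dg set" where
  "dg_space N k = {v. \<forall>i\<in>{1..N}. degree (v i) \<le> k}"

definition dg_vspace :: "nat \<Rightarrow> nat \<Rightarrow> nat \<Rightarrow> dg_vec set" where
  "dg_vspace N m k = {v. \<forall>l\<in>{1..m}. (\<lambda>i. v i l) \<in> dg_space N k}"

text \<open>General cellwise vector functions, such as \<open>\<xi>(\<rho>\<^sub>h)\<close>: arguments are the cell and the point.\<close>

type_synonym cell_fun = "nat \<Rightarrow> real \<Rightarrow> rvec"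

definition dg_val :: "nat \<Rightarrow> dg_vec \<Rightarrow> cell_fun" where
  "dg_val m v i x = (\<lambda>l\<in>{1..m}. poly (v i l) x)"

definition gl_quad :: "nat \<Rightarrow> nat \<Rightarrow> mesh \<Rightarrow> nat \<Rightarrow> cell_fun \<Rightarrow> cell_fun \<Rightarrow> real" where
  "gl_quad k m xf i \<phi> \<psi> = cell_size xf i / 2 *
     (\<Sum>r=1..k+1. gl_weight k r *
        (\<Sum>l=1..m. \<phi> i (gl_node k xf i r) l * \<psi> i (gl_node k xf i r) l))"

text \<open>The quadrature of \<open>\<phi> \<cdot> \<partial>\<^sub>x \<psi>\<close>, in which \<open>\<psi>\<close> is interpolated before it is differentiated.\<close>

definition gl_quad_deriv :: "nat \<Rightarrow> nat \<Rightarrow> mesh \<Rightarrow> nat \<Rightarrow> cell_fun \<Rightarrow> cell_fun \<Rightarrow> real" where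
  "gl_quad_deriv k m xf i \<phi> \<psi> = cell_size xf i / 2 *
     (\<Sum>r=1..k+1. gl_weight k r *
        (\<Sum>l=1..m. \<phi> i (gl_node k xf i r) l *
           poly (pderiv (interpolant k (gl_node k xf i) (\<lambda>y. \<psi> i y l))) (gl_node k xf i r)))"

definition cell_average :: "mesh \<Rightarrow> dg \<Rightarrow> nat \<Rightarrow> real" where
  "cell_average xf v i = integral {xf (i - 1)..xf i} (poly (v i)) / cell_size xf i"

text \<open>Left and right limits at interface j; the interfaces 0 and N are identified.\<close>

definition left_trace :: "nat \<Rightarrow> mesh \<Rightarrow> cell_fun \<Rightarrow> nat \<Rightarrow> rvec" where
  "left_trace N xf v j = (if j = 0 then v N (xf N) else v j (xf j))"

definition right_trace :: "nat \<Rightarrow> mesh \<Rightarrow> cell_fun \<Rightarrow> nat \<Rightarrow> rvec" where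
  "right_trace N xf v j = (if j = N then v 1 (xf 0) else v (j + 1) (xf j))"

definition face_mean :: "nat \<Rightarrow> mesh \<Rightarrow> cell_fun \<Rightarrow> nat \<Rightarrow> rvec" where
  "face_mean N xf v j l = (right_trace N xf v j l + left_trace N xf v j l) / 2"

definition face_jump :: "nat \<Rightarrow> mesh \<Rightarrow> cell_fun \<Rightarrow> nat \<Rightarrow> rvec" where
  "face_jump N xf v j l = right_trace N xf v j l - left_trace N xf v j l"


section \<open>The Euler forward scheme\<close>

definition xi_h :: "nat \<Rightarrow> (rvec \<Rightarrow> real) \<Rightarrow> dg_vec \<Rightarrow> cell_fun" where
  "xi_h m e \<rho> i x = entropy_var m e (dg_val m \<rho> i x)"

definition Fu_h :: "nat \<Rightarrow> (rvec \<Rightarrow> rmat) \<Rightarrow> dg_vec \<Rightarrow> dg_vec \<Rightarrow> cell_fun" where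
  "Fu_h m F \<rho> u i x = mat_vec m (F (dg_val m \<rho> i x)) (dg_val m u i x)"

text \<open>\<open>v\<^sub>h = diag(\<rho>)\<^sup>-\<^sup>1 F(\<rho>) u\<^sub>h\<close>, that is, \<open>G(\<rho>) u\<^sub>h\<close>.\<close>

definition v_h :: "nat \<Rightarrow> (rvec \<Rightarrow> rmat) \<Rightarrow> dg_vec \<Rightarrow> dg_vec \<Rightarrow> cell_fun" where
  "v_h m G \<rho> u i x = mat_vec m (G (dg_val m \<rho> i x)) (dg_val m u i x)"

definition lf_alpha ::
    "nat \<Rightarrow> nat \<Rightarrow> mesh \<Rightarrow> (rvec \<Rightarrow> rmat) \<Rightarrow> dg_vec \<Rightarrow> dg_vec \<Rightarrow> nat \<Rightarrow> real" where
  "lf_alpha N m xf G \<rho> u j =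
     max (linf_norm m (right_trace N xf (v_h m G \<rho> u) j))
         (linf_norm m (left_trace N xf (v_h m G \<rho> u) j))"

definition lf_flux ::
    "nat \<Rightarrow> nat \<Rightarrow> mesh \<Rightarrow> (rvec \<Rightarrow> rmat) \<Rightarrow> (rvec \<Rightarrow> rmat) \<Rightarrow> dg_vec \<Rightarrow> dg_vec \<Rightarrow> nat \<Rightarrow> rvec" where
  "lf_flux N m xf F G \<rho> u j l =
     face_mean N xf (Fu_h m F \<rho> u) j l
     + lf_alpha N m xf G \<rho> u j / 2 * face_jump N xf (dg_val m \<rho>) j l"

definition auxiliary_eq ::
    "nat \<Rightarrow> nat \<Rightarrow> nat \<Rightarrow> mesh \<Rightarrow> (rvec \<Rightarrow> real) \<Rightarrow> dg_vec \<Rightarrow> dg_vec \<Rightarrow> bool" where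
  "auxiliary_eq N k m xf e \<rho> u \<longleftrightarrow> u \<in> dg_vspace N m k \<and>
     (\<forall>\<psi>\<in>dg_vspace N m k. \<forall>i\<in>{1..N}.
        gl_quad k m xf i (dg_val m u) (dg_val m \<psi>) =
          - gl_quad_deriv k m xf i (xi_h m e \<rho>) (dg_val m \<psi>)
          + (\<Sum>l=1..m. face_mean N xf (xi_h m e \<rho>) i l * left_trace N xf (dg_val m \<psi>) i l)
          - (\<Sum>l=1..m. face_mean N xf (xi_h m e \<rho>) (i - 1) l
                * right_trace N xf (dg_val m \<psi>) (i - 1) l))"

definition euler_eq ::
    "nat \<Rightarrow> nat \<Rightarrow> nat \<Rightarrow> mesh \<Rightarrow> (rvec \<Rightarrow> rmat) \<Rightarrow> (rvec \<Rightarrow> rmat) \<Rightarrow> real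
      \<Rightarrow> dg_vec \<Rightarrow> dg_vec \<Rightarrow> dg_vec \<Rightarrow> bool" where
  "euler_eq N k m xf F G \<tau> \<rho> u \<rho>pre \<longleftrightarrow> \<rho>pre \<in> dg_vspace N m k \<and>
     (\<forall>\<phi>\<in>dg_vspace N m k. \<forall>i\<in>{1..N}.
        gl_quad k m xf i (\<lambda>i x l. (dg_val m \<rho>pre i x l - dg_val m \<rho> i x l) / \<tau>) (dg_val m \<phi>) =
          - gl_quad_deriv k m xf i (Fu_h m F \<rho> u) (dg_val m \<phi>)
          + (\<Sum>l=1..m. lf_flux N m xf F G \<rho> u i l * left_trace N xf (dg_val m \<phi>) i l)
          - (\<Sum>l=1..m. lf_flux N m xf F G \<rho> u (i - 1) l
                * right_trace N xf (dg_val m \<phi>) (i - 1) l))"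

text \<open>
  One Euler forward step from \<open>\<rho>\<close>.  The condition on S says that \<open>\<xi>(\<rho>)\<close> and \<open>F(\<rho>)\<close> are well-defined
  wherever the scheme evaluates them.
\<close>

definition euler_step ::
    "nat \<Rightarrow> nat \<Rightarrow> nat \<Rightarrow> mesh \<Rightarrow> rvec set \<Rightarrow> (rvec \<Rightarrow> real) \<Rightarrow> (rvec \<Rightarrow> rmat) \<Rightarrow> (rvec \<Rightarrow> rmat) \<Rightarrow> real
      \<Rightarrow> dg_vec \<Rightarrow> dg_vec \<Rightarrow> dg_vec \<Rightarrow> bool" where
  "euler_step N k m xf S e F G \<tau> \<rho> u \<rho>pre \<longleftrightarrow>
     0 < \<tau> \<and> \<rho> \<in> dg_vspace N m k \<and>
     (\<forall>i\<in>{1..N}. \<forall>r\<in>{1..k+1}. dg_val m \<rho> i (gl_node k xf i r) \<in> S) \<and>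
     auxiliary_eq N k m xf e \<rho> u \<and> euler_eq N k m xf F G \<tau> \<rho> u \<rho>pre"

text \<open>
  The bound on the time step.  A positive extended real divided by 0 is infinite, which is the
  intended meaning of a quotient with zero denominator (the numerators are positive).
\<close>

definition cfl_bound ::
    "nat \<Rightarrow> nat \<Rightarrow> nat \<Rightarrow> mesh \<Rightarrow> (rvec \<Rightarrow> rmat) \<Rightarrow> dg_vec \<Rightarrow> dg_vec \<Rightarrow> nat \<Rightarrow> ereal" where
  "cfl_bound N k m xf G \<rho> u l =
     (MIN i\<in>{1..N}. min
        (ereal (gl_weight k 1 * cell_size xf i)
           / ereal (lf_alpha N m xf G \<rho> u (i - 1) + right_trace N xf (v_h m G \<rho> u) (i - 1) l))
        (ereal (gl_weight k (k + 1) * cell_size xf i)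
           / ereal (lf_alpha N m xf G \<rho> u i - left_trace N xf (v_h m G \<rho> u) i l)))"


section \<open>The scaling limiter, for one component\<close>

definition node_min :: "nat \<Rightarrow> mesh \<Rightarrow> dg \<Rightarrow> nat \<Rightarrow> real" where
  "node_min k xf v i = (MIN r\<in>{1..k+1}. poly (v i) (gl_node k xf i r))"

definition limiter_theta :: "nat \<Rightarrow> mesh \<Rightarrow> dg \<Rightarrow> nat \<Rightarrow> real" where
  "limiter_theta k xf v i =
     (if cell_average xf v i = node_min k xf v i then 1
      else min (cell_average xf v i / (cell_average xf v i - node_min k xf v i)) 1)"

definition is_limited :: "nat \<Rightarrow> nat \<Rightarrow> mesh \<Rightarrow> dg \<Rightarrow> dg \<Rightarrow> bool" where
  "is_limited N k xf v w \<longleftrightarrow> w \<in> dg_space N k \<and>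
     (\<forall>i\<in>{1..N}. \<forall>r\<in>{1..k+1}.
        poly (w i) (gl_node k xf i r) =
          cell_average xf v i
          + limiter_theta k xf v i * (poly (v i) (gl_node k xf i r) - cell_average xf v i))"

end

theory Submission
  imports Defs
begin

text \<open>
  Testing (E) with the indicator of a cell expresses the new cell average through the old one and the
  two interface fluxes.  Because \<open>F = diag(\<rho>) G\<close> and \<open>\<alpha>\<close> dominates \<open>v\<^sub>h\<close>, the outgoing flux at each
  interface is a multiple of a nodal value of \<open>\<rho>\<close> that also occurs, with the positive Gauss--Lobatto
  weight \<open>w\<^sub>1\<close> or \<open>w\<^bsub>k+1\<^esub>\<close>, in the old average; the time step restriction makes the net coefficient
  non-negative.  Positivity of the weights follows from exactness in degree \<open>2k - 1\<close>, hence from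
  the orthogonality of the Legendre polynomial.

  For the accuracy, the limited polynomial minus the original one v, with average a and nodal minimum m,
  is \<open>(1 - \<theta>) (a - v)\<close>.  The oscillation of v is at most a multiple of \<open>a - m\<close> depending only on the
  Lebesgue constant and the weights, while \<open>(1 - \<theta>) (a - m)\<close> is the undershoot \<open>max 0 (-m)\<close>, and a
  non-negative solution differs from v by at least that much at the minimal node.
\<close>

section \<open>Gauss--Lobatto nodes, exactness and positive weights\<close>

lemma poly_integrable [simp]: "poly p integrable_on {a..b}" for p :: "real poly"
  by (intro integrable_continuous_real continuous_intros)

lemma integral_poly_add:
  "integral {a..b} (poly (p + q)) = integral {a..b} (poly p) + integral {a..b} (poly q)" for p q :: "real poly"
proof -
  have "poly (p + q) = (\<lambda>x. poly p x + poly q x)" by (rule ext) simp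
  then show ?thesis by (simp add: integral_add)
qed

lemma integral_poly_0 [simp]: "integral A (poly (0 :: real poly)) = 0"
proof -
  have "poly (0 :: real poly) = (\<lambda>x. 0)" by (rule ext) simp
  then show ?thesis by simp
qed

lemma integral_poly_smult: "integral {a..b} (poly (smult c p)) = c * integral {a..b} (poly p)"
  for p :: "real poly"
proof -
  have "poly (smult c p) = (\<lambda>x. c * poly p x)" by (rule ext) simp
  then show ?thesis by simp
qed

lemma integral_poly_sum_smult:
  "integral {a..b} (poly (\<Sum>r\<in>A. smult (c r) (p r))) = (\<Sum>r\<in>A. c r * integral {a..b} (poly (p r)))"
  for p :: "'a \<Rightarrow> real poly"
proof (cases "finite A")
  case True
  have "poly (\<Sum>r\<in>A. smult (c r) (p r)) = (\<lambda>x. \<Sum>r\<in>A. c r * poly (p r) x)"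
    by (rule ext) (simp add: poly_sum)
  moreover have "((\<lambda>x. \<Sum>r\<in>A. c r * poly (p r) x) has_integral (\<Sum>r\<in>A. c r * integral {a..b} (poly (p r)))) {a..b}"
    using True by (intro has_integral_sum has_integral_mult_right integrable_integral poly_integrable)
  ultimately show ?thesis by (simp add: integral_unique)
qed simp

lemma integral_poly_pderiv:
  fixes p :: "real poly"
  assumes "a \<le> b"
  shows "integral {a..b} (poly (pderiv p)) = poly p b - poly p a"
proof -
  have "(poly (pderiv p) has_integral (poly p b - poly p a)) {a..b}"
  proof (rule fundamental_theorem_of_calculus[OF assms])
    show "(poly p has_vector_derivative poly (pderiv p) x) (at x within {a..b})" for x
      using has_field_derivative_at_within[OF poly_DERIV[of p x]]
      by (simp add: has_real_derivative_iff_has_vector_derivative)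
  qed
  then show ?thesis by (rule integral_unique)
qed

lemma integral_poly_by_parts:
  fixes p :: "real poly"
  assumes "a \<le> b" "poly p a = 0" "poly p b = 0"
  shows "integral {a..b} (poly (pderiv p * q)) = - integral {a..b} (poly (p * pderiv q))"
proof -
  have "integral {a..b} (poly (pderiv (p * q))) = 0"
    using assms by (subst integral_poly_pderiv) auto
  then show ?thesis
    by (simp add: pderiv_mult integral_poly_add mult.commute)
qed

section \<open>Derivatives of \<open>(z^2 - 1)^k\<close>: endpoint zeros and orthogonality\<close>

text \<open>By the product rule each differentiation removes at most one factor \<open>d\<close>.
  Truncated subtraction makes the claim trivial once \<open>j\<close> reaches
  \<open>n\<close>.\<close>

lemma funpow_pderiv_power_dvd:
  "d ^ (n - j) dvd (pderiv ^^ j) (d ^ n)" for d :: "real poly"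
proof (induction j)
  case (Suc j)
  show ?case
  proof (cases "n - j")
    case 0
    then have "n - Suc j = 0" by simp
    then show ?thesis by (metis one_dvd power_0)
  next
    case (Suc i)
    have "d ^ Suc i dvd (pderiv ^^ j) (d ^ n)" using Suc.IH unfolding Suc .
    then obtain q where q: "(pderiv ^^ j) (d ^ n) = d ^ Suc i * q" by (rule dvdE)
    have "(pderiv ^^ Suc j) (d ^ n) = d ^ i * (d * pderiv q + q * smult (of_nat (Suc i)) (pderiv d))"
      unfolding funpow.simps o_apply q pderiv_mult pderiv_power_Suc
      by (simp only: power_Suc distrib_left mult_smult_left mult_smult_right mult_ac)
    moreover have "n - Suc j = i" using Suc by simp
    ultimately show ?thesis by simp
  qed
qed simp

text \<open>A factor \<open>z^2 - 1\<close> survives fewer than \<open>k\<close> differentiations.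
  The resulting zeros kill boundary terms in integration by parts and feed Rolle's theorem.\<close>

lemma funpow_pderiv_endpoints:
  assumes "j < k"
  shows "poly ((pderiv ^^ j) ([:-1, 0, 1:] ^ k)) (-1) = (0::real)"
    and "poly ((pderiv ^^ j) ([:-1, 0, 1:] ^ k)) 1 = (0::real)"
proof -
  have "[:-1, 0, 1::real:] dvd [:-1, 0, 1:] ^ (k - j)"
    using assms by (intro dvd_power) auto
  then have "[:-1, 0, 1::real:] dvd (pderiv ^^ j) ([:-1, 0, 1:] ^ k)"
    using funpow_pderiv_power_dvd dvd_trans by blast
  then obtain q where "(pderiv ^^ j) ([:-1, 0, 1::real:] ^ k) = [:-1, 0, 1:] * q" by (rule dvdE)
  then show "poly ((pderiv ^^ j) ([:-1, 0, 1:] ^ k)) (-1) = (0::real)"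
    and "poly ((pderiv ^^ j) ([:-1, 0, 1:] ^ k)) 1 = (0::real)"
    by (simp_all only: poly_mult) simp_all
qed

text \<open>Each integration by parts moves one derivative onto \<open>q\<close> without boundary
  terms. The exponent \<open>k\<close> stays fixed while \<open>j\<close> decreases, so that the
  endpoint zeros remain available.\<close>

lemma rodrigues_orthogonal:
  assumes "j \<le> k" "degree q < j"
  shows "integral {-1..1} (poly ((pderiv ^^ j) ([:-1, 0, 1:] ^ k) * q)) = (0::real)"
  using assms
proof (induction j arbitrary: q)
  case (Suc j)
  have "integral {-1..1} (poly ((pderiv ^^ j) ([:-1, 0, 1:] ^ k) * pderiv q)) = 0"
  \<comment> \<open>A constant \<open>q\<close> is separate: its degree does not drop under
    differentiation, and \<open>j\<close> may be 0, where the induction hypothesis would be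
    vacuous.\<close>
  proof (cases "degree q = 0")
    case True
    then have "pderiv q = 0" by (simp add: pderiv_eq_0_iff)
    then show ?thesis by simp
  next
    case False
    then show ?thesis using Suc by (intro Suc.IH) (auto simp: degree_pderiv)
  qed
  moreover have "poly ((pderiv ^^ j) ([:-1, 0, 1:] ^ k)) (-1) = (0::real)"
    "poly ((pderiv ^^ j) ([:-1, 0, 1:] ^ k)) 1 = (0::real)"
    using Suc.prems by (auto intro: funpow_pderiv_endpoints)
  ultimately show ?case unfolding funpow.simps o_apply by (subst integral_poly_by_parts) auto
qed simp

lemma legendre_orthogonal:
  assumes "degree q < k"
  shows "integral {-1..1} (poly (legendre k * q)) = 0"
proof -
  have "legendre k * q = smult (1 / (2 ^ k * fact k)) ((pderiv ^^ k) ([:-1, 0, 1:] ^ k) * q)"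
    by (simp add: legendre_def)
  then show ?thesis using rodrigues_orthogonal[OF order_refl assms] by (simp add: integral_poly_smult)
qed

section \<open>Counting real zeros by Rolle's theorem\<close>

text \<open>Induction on the largest zero \<open>c\<close>. With \<open>M\<close> the largest zero
  below \<open>c\<close>, the induction hypothesis on \<open>{a..M}\<close> gives zeros of the
  derivative left of \<open>M\<close>, and the mean value theorem adds one between \<open>M\<close>
  and \<open>c\<close>, necessarily new.\<close>

lemma rolle_roots:
  fixes p :: "real poly"
  assumes "finite A" "A \<subseteq> {a..b}" "\<And>z. z \<in> A \<Longrightarrow> poly p z = 0" "card A = Suc n"
  shows "\<exists>B \<subseteq> {a<..<b}. finite B \<and> card B = n \<and> (\<forall>z\<in>B. poly (pderiv p) z = 0)"
  using assms
proof (induction A arbitrary: b n rule: finite_linorder_max_induct)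
  case (insert c A)
  show ?case
  proof (cases "A = {}")
    case True
    then show ?thesis using insert.prems by (intro exI[of _ "{}"]) auto
  next
    case False
    define M where "M = Max A"
    have M: "M \<in> A" "\<And>z. z \<in> A \<Longrightarrow> z \<le> M" using False insert.hyps by (auto simp: M_def)
    have cA: "card A = n" using insert by auto
    then obtain n' where n': "n = Suc n'" using False insert.hyps by (cases n) auto
    obtain B where B: "B \<subseteq> {a<..<M}" "finite B" "card B = n'" "\<forall>z\<in>B. poly (pderiv p) z = 0"
      using insert.IH[of M n'] insert.prems cA n' M by (auto simp: subset_iff)
    have Mc: "M < c" using M insert.hyps by auto
    obtain x where x: "M < x" "x < c" "poly p c - poly p M = (c - M) * poly (pderiv p) x"
      using poly_MVT[OF Mc] by blast
    have "poly (pderiv p) x = 0" using x Mc insert.prems M by auto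
    moreover have "a \<le> M" "c \<le> b" using M insert.prems by auto
    moreover have "x \<notin> B" using B x by auto
    ultimately show ?thesis using B x n'
      by (intro exI[of _ "insert x B"]) force
  qed
qed simp

text \<open>While \<open>j < k\<close>, both endpoints are zeros besides the \<open>j\<close>
  interior ones, so Rolle turns \<open>j + 2\<close> zeros into \<open>j + 1\<close> interior zeros
  of the next derivative.\<close>

lemma rodrigues_roots:
  assumes "j \<le> k"
  shows "\<exists>B \<subseteq> {-1<..<1}. finite B \<and> card B = j \<and>
    (\<forall>z\<in>B. poly ((pderiv ^^ j) ([:-1, 0, 1:] ^ k)) z = (0::real))"
  using assms
proof (induction j)
  case (Suc j)
  then obtain B where B: "B \<subseteq> {-1<..<1}" "finite B" "card B = j"
    "\<forall>z\<in>B. poly ((pderiv ^^ j) ([:-1, 0, 1:] ^ k)) z = (0::real)" by auto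
  have "-1 \<notin> B" "1 \<notin> B" using B by auto
  then have "card (insert (-1) (insert 1 B)) = Suc (Suc j)" using B by simp
  then have "\<exists>B \<subseteq> {-1<..<1}. finite B \<and> card B = Suc j \<and>
      (\<forall>z\<in>B. poly (pderiv ((pderiv ^^ j) ([:-1, 0, 1:] ^ k))) z = (0::real))"
    using B Suc.prems funpow_pderiv_endpoints[of j k]
    by (intro rolle_roots[of "insert (-1) (insert 1 B)"]) auto
  then show ?case by simp
qed (intro exI[of _ "{}"], simp)

lemma degree_legendre: "degree (legendre k) = k"
proof -
  have "degree ((pderiv ^^ j) p) = degree p - j" for p :: "real poly" and j
    by (induction j) (auto simp: degree_pderiv)
  then show ?thesis by (simp add: legendre_def degree_power_eq)
qed

section \<open>The Gauss--Lobatto nodes as zeros of a polynomial\<close>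

text \<open>The polynomial inside \<open>gl_point\<close>, named because it also serves as the
  divisor in the proof of exactness.\<close>

definition gl_poly :: "nat \<Rightarrow> real poly" where
  "gl_poly k = [:1, 0, -1:] * pderiv (legendre k)"

lemma degree_gl_poly:
  assumes "1 \<le> k"
  shows "degree (gl_poly k) = k + 1" "gl_poly k \<noteq> 0"
proof -
  have nz: "pderiv (legendre k) \<noteq> 0" using assms by (simp add: pderiv_eq_0_iff degree_legendre)
  then show "gl_poly k \<noteq> 0" unfolding gl_poly_def by (intro mult_not_zero no_zero_divisors) auto
  show "degree (gl_poly k) = k + 1"
    using nz assms unfolding gl_poly_def by (subst degree_mult_eq) (auto simp: degree_pderiv degree_legendre)
qed

text \<open>Rolle gives \<open>k - 1\<close> interior zeros of the derivative of
  \<open>legendre k\<close>. With the two endpoints these exhaust the degree \<open>k + 1\<close>,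
  so there are no other real zeros.\<close>

lemma gl_poly_roots:
  assumes "1 \<le> k"
  shows "finite {z. poly (gl_poly k) z = 0}" "card {z. poly (gl_poly k) z = 0} = k + 1"
    "{z. poly (gl_poly k) z = 0} \<subseteq> {-1..1}" 
    "poly (gl_poly k) (-1) = 0" "poly (gl_poly k) 1 = 0"
proof -
  let ?Z = "{z. poly (gl_poly k) z = 0}"
  obtain A where A: "A \<subseteq> {-1<..<1}" "finite A" "card A = k"
    "\<forall>z\<in>A. poly ((pderiv ^^ k) ([:-1, 0, 1:] ^ k)) z = (0::real)"
    using rodrigues_roots[of k k] by auto
  obtain B where B: "B \<subseteq> {-1<..<1}" "finite B" "card B = k - 1" "\<forall>z\<in>B. poly (pderiv (legendre k)) z = 0"
  proof -
    have "A \<subseteq> {-1..1}" "card A = Suc (k - 1)" using A assms by auto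
    moreover have "poly (legendre k) z = 0" if "z \<in> A" for z using A(4) that by (simp add: legendre_def)
    ultimately show thesis using rolle_roots[of A "-1" 1 "legendre k" "k - 1"] A(2) that by blast
  qed
  have "-1 \<notin> B" "1 \<notin> B" using B by auto
  then have c: "card (insert (-1) (insert 1 B)) = k + 1" using B assms by simp
  have sub: "insert (-1) (insert 1 B) \<subseteq> ?Z" using B by (auto simp: gl_poly_def)
  show fin: "finite ?Z" using degree_gl_poly[OF assms] by (simp add: poly_roots_finite)
  have "card ?Z \<le> k + 1" using card_poly_roots_bound[of "gl_poly k"] degree_gl_poly[OF assms] by simp
  then have eq: "insert (-1) (insert 1 B) = ?Z" using card_seteq[OF fin sub] c by simp
  show "card ?Z = k + 1" using eq c by simp
  show "?Z \<subseteq> {-1..1}" unfolding eq[symmetric] using B by auto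
  show "poly (gl_poly k) (-1) = 0" "poly (gl_poly k) 1 = 0" by (auto simp: gl_poly_def)
qed

text \<open>The sorted list in \<open>gl_point\<close> has exactly \<open>k + 1\<close> entries, so
  the shifted index \<open>r - 1\<close> is valid for every \<open>r\<close> in
  \<open>{1..k+1}\<close> and each zero is hit.\<close>

lemma gl_point_roots:
  assumes "1 \<le> k"
  shows "gl_point k ` {1..k+1} = {z. poly (gl_poly k) z = 0}"
    and "strict_mono_on {1..k+1} (gl_point k)"
proof -
  let ?Z = "{z. poly (gl_poly k) z = 0}"
  define xs where "xs = sorted_list_of_set ?Z"
  have g: "gl_point k r = xs ! (r - 1)" for r by (simp add: gl_point_def xs_def gl_poly_def)
  have len: "length xs = k + 1" and set: "set xs = ?Z" and srt: "sorted_wrt (<) xs"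
    using gl_poly_roots[OF assms] by (simp_all add: xs_def)
  show "strict_mono_on {1..k+1} (gl_point k)"
    using srt len by (auto simp: strict_mono_on_def g intro!: sorted_wrt_nth_less[of "(<)"])
  have "gl_point k ` {1..k+1} = (\<lambda>i. xs ! i) ` ((\<lambda>r. r - 1) ` {1..k+1})" by (auto simp: g)
  also have "(\<lambda>r. r - 1) ` {1..k+1} = {..<k+1}" 
  proof (intro equalityI subsetI)
    fix i assume "i \<in> {..<k+1}"
    then show "i \<in> (\<lambda>r. r - 1) ` {1..k+1}" by (intro image_eqI[of _ _ "Suc i"]) auto
  qed auto
  also have "(\<lambda>i. xs ! i) ` {..<k+1} = set xs" using len by (auto simp: set_conv_nth)
  finally show "gl_point k ` {1..k+1} = ?Z" using set by simp
qed

lemma gl_point_inj: "1 \<le> k \<Longrightarrow> inj_on (gl_point k) {1..k+1}"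
  using gl_point_roots(2) by (rule strict_mono_on_imp_inj_on)

lemma gl_point_bounds:
  assumes "1 \<le> k" "r \<in> {1..k+1}"
  shows "- 1 \<le> gl_point k r" "gl_point k r \<le> 1"
proof -
  have "gl_point k r \<in> {-1..1}"
    using gl_point_roots(1)[OF assms(1)] gl_poly_roots(3)[OF assms(1)] assms(2) by blast
  then show "- 1 \<le> gl_point k r" "gl_point k r \<le> 1" by auto
qed

text \<open>Both endpoints are nodes, and no node lies outside \<open>[-1, 1]\<close>; monotonicity
  then makes them the first and the last.\<close>

lemma gl_point_endpoints:
  assumes "1 \<le> k"
  shows "gl_point k 1 = - 1" "gl_point k (k + 1) = 1"
proof -
  have mono: "gl_point k r \<le> gl_point k s" if "r \<in> {1..k+1}" "s \<in> {1..k+1}" "r \<le> s" for r s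
    using that strict_mono_onD[OF gl_point_roots(2)[OF assms], of r s] by (cases "r = s") auto
  have "- 1 \<in> gl_point k ` {1..k+1}" "1 \<in> gl_point k ` {1..k+1}"
    using gl_point_roots(1)[OF assms] gl_poly_roots(4,5)[OF assms] by auto
  then obtain r s where "r \<in> {1..k+1}" "gl_point k r = - 1" "s \<in> {1..k+1}" "gl_point k s = 1"
    by (metis imageE)
  then show "gl_point k 1 = - 1" "gl_point k (k + 1) = 1"
    using mono[of 1 r] mono[of s "k + 1"] gl_point_bounds[OF assms, of 1] gl_point_bounds[OF assms, of "k + 1"]
    by auto
qed

section \<open>Lagrange interpolation\<close>

lemma degree_lagrange_basis:
  assumes "r \<in> {1..k+1}"
  shows "degree (lagrange_basis k z r) \<le> k"
proof -
  have "degree (lagrange_basis k z r)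
      \<le> (\<Sum>s\<in>{1..k+1} - {r}. degree (smult (1 / (z r - z s)) [:- z s, 1:]))"
    unfolding lagrange_basis_def by (rule order_trans[OF degree_prod_sum_le]) (auto simp: o_def)
  also have "\<dots> \<le> (\<Sum>s\<in>{1..k+1} - {r}. 1)" by (intro sum_mono) auto
  also have "\<dots> = k" using assms by simp
  finally show ?thesis .
qed

lemma poly_lagrange_basis:
  assumes "inj_on z {1..k+1}" "r \<in> {1..k+1}" "s \<in> {1..k+1}"
  shows "poly (lagrange_basis k z r) (z s) = (if s = r then 1 else 0)"
proof (cases "s = r")
  case True
  have "z r - z t \<noteq> 0" if "t \<in> {1..k+1} - {r}" for t
    using that assms by (auto dest: inj_onD)
  then have "poly (smult (1 / (z r - z t)) [:- z t, 1:]) (z r) = 1" if "t \<in> {1..k+1} - {r}" for t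
    using that by (simp add: diff_divide_distrib[symmetric])
  then show ?thesis using True by (simp add: lagrange_basis_def poly_prod)
next
  case False
  then have "s \<in> {1..k+1} - {r}" using assms by auto
  then show ?thesis using False by (auto simp: lagrange_basis_def poly_prod intro!: prod_zero bexI[of _ s])
qed

text \<open>Both sides have degree at most \<open>k\<close> and agree at \<open>k + 1\<close>
  distinct points. Only nodal values of \<open>f\<close> matter, so \<open>f\<close> may be any
  function there.\<close>

lemma interpolant_eq:
  assumes "inj_on z {1..k+1}" "degree p \<le> k" "\<And>r. r \<in> {1..k+1} \<Longrightarrow> f (z r) = poly p (z r)"
  shows "interpolant k z f = p"
proof (rule poly_eqI_degree[where A = "z ` {1..k+1}"])
  show "poly (interpolant k z f) x = poly p x" if "x \<in> z ` {1..k+1}" for x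
  proof -
    obtain s where s: "s \<in> {1..k+1}" "x = z s" using \<open>x \<in> z ` {1..k+1}\<close> by blast
    have "poly (interpolant k z f) x = (\<Sum>r=1..k+1. f (z r) * (if s = r then 1 else 0))"
      unfolding interpolant_def poly_sum
      by (intro sum.cong refl) (simp add: s poly_lagrange_basis[OF assms(1) _ s(1)])
    also have "\<dots> = f (z s)" using s by (simp add: if_distrib cong: if_cong)
    finally show ?thesis using assms(3)[OF s(1)] s by simp
  qed
  have c: "card (z ` {1..k+1}) = k + 1" using assms(1) by (simp add: card_image)
  show "degree p < card (z ` {1..k+1})" using assms(2) c by simp
  have "degree (interpolant k z f) \<le> k" unfolding interpolant_def
    by (intro degree_sum_le) (auto intro!: order_trans[OF degree_smult_le degree_lagrange_basis] simp del: degree_smult_eq)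
  then show "degree (interpolant k z f) < card (z ` {1..k+1})" using c by simp
qed

lemma poly_eq_lagrange:
  assumes "inj_on z {1..k+1}" "degree p \<le> k"
  shows "p = (\<Sum>r=1..k+1. smult (poly p (z r)) (lagrange_basis k z r))"
  using interpolant_eq[OF assms, of "poly p"] by (simp add: interpolant_def)

section \<open>Exactness of the quadrature and positivity of its weights\<close>

text \<open>The weights are integrals of the Lagrange basis, so integrating the interpolation
  formula term by term gives the rule.\<close>

lemma gl_exact_low_degree:
  assumes "1 \<le> k" "degree p \<le> k"
  shows "integral {-1..1} (poly p) = (\<Sum>r=1..k+1. gl_weight k r * poly p (gl_point k r))"
  by (subst poly_eq_lagrange[OF gl_point_inj[OF assms(1)] assms(2)])
    (simp only: integral_poly_sum_smult gl_weight_def mult.commute)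

text \<open>Division by \<open>gl_poly k\<close> leaves the nodal values of p unchanged in the remainder; the quotient
  part integrates to zero, by parts and by orthogonality of \<open>legendre k\<close> to lower degrees.\<close>

lemma gl_exact:
  assumes k: "1 \<le> k" and p: "degree p < 2 * k"
  shows "integral {-1..1} (poly p) = (\<Sum>r=1..k+1. gl_weight k r * poly p (gl_point k r))"
proof -
  define q where "q = p div gl_poly k"
  define s where "s = p mod gl_poly k"
  have p_eq: "p = q * gl_poly k + s" by (simp add: q_def s_def)
  have s: "degree s \<le> k"
    using degree_mod_less[of "gl_poly k" p] degree_gl_poly[OF k] by (auto simp: s_def)
  have "integral {-1..1} (poly (q * gl_poly k)) = 0"
  proof (cases "q = 0")
    case False
    \<comment> \<open>Removing the divisor's degree \<open>k + 1\<close> from at most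
      \<open>2 * k - 1\<close> leaves at most \<open>k - 2\<close> for \<open>q\<close>.\<close>
    have "degree q + (k + 1) = degree (q * gl_poly k)"
      using False degree_gl_poly[OF k] by (simp add: degree_mult_eq)
    also have "\<dots> = degree (p - s)" by (simp add: p_eq)
    also have "\<dots> \<le> 2 * k - 1" using p s k by (intro degree_diff_le) auto
    finally have dq: "degree q + 2 \<le> k" using k by linarith
    \<comment> \<open>Keeping \<open>1 - z^2\<close> with \<open>q\<close> makes the boundary terms
      vanish, and the derivative of \<open>?g\<close> still has degree below
      \<open>k\<close>.\<close>
    let ?g = "q * [:1, 0, -1:]"
    have "degree ?g \<le> k" using dq degree_mult_le[of q "[:1, 0, -1:]"] by simp
    then have "degree (pderiv ?g) < k" using k by (auto simp: degree_pderiv)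
    from legendre_orthogonal[OF this]
    have "integral {-1..1} (poly (pderiv ?g * legendre k)) = 0" by (simp add: mult.commute)
    then have "integral {-1..1} (poly (?g * pderiv (legendre k))) = 0"
      by (subst (asm) integral_poly_by_parts) auto
    then show ?thesis by (simp only: gl_poly_def mult.assoc)
  qed simp
  then have "integral {-1..1} (poly p) = integral {-1..1} (poly s)"
    by (simp only: p_eq integral_poly_add add_0)
  also have "\<dots> = (\<Sum>r=1..k+1. gl_weight k r * poly s (gl_point k r))"
    by (rule gl_exact_low_degree[OF k s])
  also have "\<dots> = (\<Sum>r=1..k+1. gl_weight k r * poly p (gl_point k r))"
  proof (intro sum.cong refl)
    fix r assume "r \<in> {1..k+1}"
    then have "poly (gl_poly k) (gl_point k r) = 0" using gl_point_roots(1)[OF k] by blast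
    then show "gl_weight k r * poly s (gl_point k r) = gl_weight k r * poly p (gl_point k r)"
      by (simp add: p_eq)
  qed
  finally show ?thesis .
qed

text \<open>Exactness is tested on a polynomial that is non-negative on \<open>[-1, 1]\<close> and
  vanishes at every node except number \<open>r\<close>. Interior nodes need squared factors, but
  the endpoint factors \<open>1 + z\<close> and \<open>1 - z\<close> already have a sign; squaring
  them too would give degree \<open>2 * k\<close>, one too many.\<close>

lemma gl_weight_pos:
  assumes k: "1 \<le> k" and r: "r \<in> {1..k+1}"
  shows "0 < gl_weight k r"
proof -
  let ?z = "gl_point k"
  define M where "M = (\<Prod>s\<in>{2..k} - {r}. [:- ?z s, 1:])"
  define c where "c s = (if s = 1 then [:1, 1:] else [:1, -1::real:])" for s :: nat
  define D where "D = (\<Prod>s\<in>{1, k + 1} - {r}. c s)"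
  define p where "p = M ^ 2 * D"
  note endp = gl_point_endpoints[OF k]
  have inj: "?z s \<noteq> ?z t" if "s \<in> {1..k+1}" "t \<in> {1..k+1}" "s \<noteq> t" for s t
    using gl_point_inj[OF k] that by (auto dest: inj_onD)
  have D_nonneg: "0 \<le> poly D x" if "x \<in> {-1..1}" for x
    using that unfolding D_def poly_prod c_def by (intro prod_nonneg) auto
  have p_nonneg: "0 \<le> poly p x" if "x \<in> {-1..1}" for x
    using D_nonneg[OF that] by (simp add: p_def)
  have "degree M \<le> card ({2..k} - {r})"
    unfolding M_def by (rule order_trans[OF degree_prod_sum_le]) (auto simp: o_def)
  moreover have "degree D \<le> card ({1, k + 1} - {r})"
  proof -
    have "degree D \<le> (\<Sum>s\<in>{1, k + 1} - {r}. degree (c s))"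
      unfolding D_def by (rule order_trans[OF degree_prod_sum_le]) (auto simp: o_def)
    also have "\<dots> \<le> (\<Sum>s\<in>{1, k + 1} - {r}. 1)" by (intro sum_mono) (auto simp: c_def)
    finally show ?thesis by simp
  qed
  \<comment> \<open>The count is \<open>2 * k - 2\<close> for an interior node \<open>r\<close> and
    \<open>2 * k - 1\<close> for an endpoint.\<close>
  moreover have "2 * card ({2..k} - {r}) + card ({1, k + 1} - {r}) < 2 * k"
  proof (cases "r \<in> {2..k}")
    case True
    then have "{1, k + 1} - {r} = {1, k + 1}" by auto
    then show ?thesis using True by auto
  next
    case False
    then have "r = 1 \<or> r = k + 1" using r by auto
    then have "card ({1, k + 1} - {r}) = 1" using k by auto
    then show ?thesis using False k by auto
  qed
  ultimately have "degree p < 2 * k"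
    using degree_mult_le[of "M ^ 2" D] degree_power_le[of M 2] by (simp add: p_def)
  then have int: "integral {-1..1} (poly p) = (\<Sum>s=1..k+1. gl_weight k s * poly p (?z s))"
    by (rule gl_exact[OF k])
  have p_zero: "poly p (?z s) = 0" if s: "s \<in> {1..k+1}" "s \<noteq> r" for s
  proof (cases "s \<in> {2..k}")
    case True
    then have "poly M (?z s) = 0"
      using s by (auto simp: M_def poly_prod intro!: prod_zero bexI[of _ s])
    then show ?thesis by (simp add: p_def)
  next
    case False
    then have s': "s = 1 \<or> s = k + 1" using s by auto
    then have "poly D (?z s) = 0"
      using s k endp by (auto simp: D_def poly_prod c_def intro!: prod_zero bexI[of _ s])
    then show ?thesis by (simp add: p_def)
  qed
  have p_r: "poly p (?z r) \<noteq> 0"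
  proof -
    have "poly M (?z r) \<noteq> 0"
      using inj[OF _ r] r by (auto simp: M_def poly_prod) (metis atLeastAtMost_iff inj le_SucI numeral_2_eq_2 Suc_leD Suc_eq_plus1)
    moreover have "poly (c s) (?z r) \<noteq> 0" if "s \<in> {1, k + 1} - {r}" for s
    proof -
      have "?z s \<noteq> ?z r" using inj[of s r] that r by auto
      then show ?thesis using that k endp by (auto simp: c_def)
    qed
    then have "poly D (?z r) \<noteq> 0" unfolding D_def poly_prod by (subst prod_zero_iff) auto
    ultimately show ?thesis by (simp add: p_def)
  qed
  have zr: "?z r \<in> {-1..1}" using gl_point_bounds[OF k r] by simp
  have "integral {-1..1} (poly p) \<noteq> 0"
  proof -
    have "continuous_on {-1..1} (poly p)" by (intro continuous_intros)
    then show ?thesis using integral_eq_0_iff[of "-1" 1 "poly p"] p_nonneg p_r zr by auto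
  qed
  moreover have "0 \<le> integral {-1..1} (poly p)" using p_nonneg by (intro integral_nonneg) auto
  moreover have "integral {-1..1} (poly p) = gl_weight k r * poly p (?z r)"
  proof -
    have "(\<Sum>s=1..k+1. gl_weight k s * poly p (?z s)) = (\<Sum>s\<in>{r}. gl_weight k s * poly p (?z s))"
      using r p_zero by (intro sum.mono_neutral_right) auto
    then show ?thesis using int by simp
  qed
  ultimately show ?thesis
    using p_nonneg[OF zr] by (metis less_eq_real_def mult_nonpos_nonneg not_le)
qed

lemma sum_gl_weight:
  assumes "1 \<le> k"
  shows "(\<Sum>r=1..k+1. gl_weight k r) = 2"
proof -
  have "poly [:1::real:] = (\<lambda>x. 1)" by (rule ext) simp
  then have "integral {-1..1} (poly [:1::real:]) = 2" by simp
  then show ?thesis using gl_exact_low_degree[OF assms, of "[:1:]"] by simp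
qed

section \<open>Quadrature and limiting on a cell\<close>

lemma integral_poly_affine:
  fixes p :: "real poly"
  assumes "a < b"
  shows "integral {a..b} (poly p)
    = (b - a) / 2 * integral {-1..1} (poly (pcompose p [:(a + b) / 2, (b - a) / 2:]))"
proof -
  let ?m = "(b - a) / 2" and ?c = "(a + b) / 2"
  have m: "0 < ?m" using assms by simp
  have "(poly p has_integral integral {a..b} (poly p)) (cbox a b)"
    using poly_integrable by (simp add: integrable_integral)
  moreover have "(a - ?c) /\<^sub>R ?m = -1" "(b - ?c) /\<^sub>R ?m = 1" using assms by (simp_all add: field_simps)
  ultimately have "((\<lambda>x. poly p (?m *\<^sub>R x + ?c)) has_integral integral {a..b} (poly p) /\<^sub>R ?m ^ DIM(real))
      (cbox (- 1) 1)"
    using has_integral_affinity'[of "poly p" _ a b ?m ?c] m by metis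
  moreover have "(\<lambda>x. poly p (?m *\<^sub>R x + ?c)) = poly (pcompose p [:?c, ?m:])"
    by (rule ext) (simp add: poly_pcompose add.commute mult.commute)
  ultimately have "integral {-1..1} (poly (pcompose p [:?c, ?m:])) = integral {a..b} (poly p) /\<^sub>R ?m ^ DIM(real)"
    by (metis integral_unique interval_cbox)
  then show ?thesis using m by simp
qed

context
  fixes k :: nat and xf :: mesh and i :: nat
  assumes k: "1 \<le> k" and cell: "xf (i - 1) < xf i"
begin

text \<open>The affine map from \<open>[-1, 1]\<close> onto the cell, encoded as a polynomial so
  that \<open>pcompose\<close> pulls back polynomials and controls their degree.\<close>

definition to_cell :: "real poly" where
  "to_cell = [:(xf (i - 1) + xf i) / 2, cell_size xf i / 2:]"

lemma poly_to_cell_gl_point: "poly to_cell (gl_point k r) = gl_node k xf i r"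
  by (simp add: to_cell_def gl_node_def)

lemma degree_pcompose_to_cell: "degree p \<le> k \<Longrightarrow> degree (pcompose p to_cell) \<le> k"
  by (rule order_trans[OF degree_pcompose_le]) (simp add: to_cell_def)

lemma gl_node_endpoints: "gl_node k xf i 1 = xf (i - 1)" "gl_node k xf i (k + 1) = xf i"
  unfolding gl_node_def gl_point_endpoints[OF k] by (simp_all add: cell_size_def field_simps)

lemma gl_node_inj: "inj_on (gl_node k xf i) {1..k+1}"
  using gl_point_inj[OF k] cell by (auto simp: inj_on_def gl_node_def cell_size_def)

lemma gl_node_in_cell:
  assumes "r \<in> {1..k+1}"
  shows "gl_node k xf i r \<in> {xf (i - 1)..xf i}"
proof -
  have h: "0 < cell_size xf i" using cell by (simp add: cell_size_def)
  have "cell_size xf i / 2 * gl_point k r \<le> cell_size xf i / 2 * 1"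
    "cell_size xf i / 2 * (-1) \<le> cell_size xf i / 2 * gl_point k r"
    using gl_point_bounds[OF k assms] h by (intro mult_left_mono; simp)+
  then show ?thesis unfolding gl_node_def cell_size_def by (simp add: field_simps)
qed

text \<open>Change of variables followed by exactness in degree at most \<open>k\<close>. The factor
  2 is the length of \<open>[-1, 1]\<close>.\<close>

lemma cell_average_quadrature:
  assumes "degree (v i) \<le> k"
  shows "2 * cell_average xf v i = (\<Sum>r=1..k+1. gl_weight k r * poly (v i) (gl_node k xf i r))"
proof -
  have "2 * cell_average xf v i = integral {-1..1} (poly (pcompose (v i) to_cell))"
  proof -
    have "integral {xf (i - 1)..xf i} (poly (v i))
        = cell_size xf i / 2 * integral {-1..1} (poly (pcompose (v i) to_cell))"
      using integral_poly_affine[OF cell] by (simp only: to_cell_def cell_size_def)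
    moreover have "0 < cell_size xf i" using cell by (simp add: cell_size_def)
    ultimately show ?thesis by (simp add: cell_average_def nonzero_divide_eq_eq mult.commute)
  qed
  also have "\<dots> = (\<Sum>r=1..k+1. gl_weight k r * poly (v i) (gl_node k xf i r))"
    using gl_exact_low_degree[OF k degree_pcompose_to_cell[OF assms]]
    by (simp only: poly_pcompose poly_to_cell_gl_point)
  finally show ?thesis .
qed

section \<open>Deviation of a polynomial from its nodal minimum\<close>

lemma node_min_le: "r \<in> {1..k+1} \<Longrightarrow> node_min k xf v i \<le> poly (v i) (gl_node k xf i r)"
  unfolding node_min_def by (intro Min_le) auto

lemma node_min_attained: "\<exists>r\<in>{1..k+1}. node_min k xf v i = poly (v i) (gl_node k xf i r)"
proof -
  have "node_min k xf v i \<in> (\<lambda>r. poly (v i) (gl_node k xf i r)) ` {1..k+1}"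
    unfolding node_min_def by (intro Min_in) auto
  then show ?thesis by blast
qed

lemma sum_gl_weight_deviation:
  assumes "degree (v i) \<le> k"
  shows "(\<Sum>r=1..k+1. gl_weight k r * (poly (v i) (gl_node k xf i r) - c))
    = 2 * (cell_average xf v i - c)"
  by (simp only: right_diff_distrib sum_subtractf sum_distrib_right[symmetric] sum_gl_weight[OF k]
    cell_average_quadrature[of v, OF assms])

text \<open>Weighted deviations from the minimum are non-negative, so each is at most their sum,
  which is twice the average minus the minimum. This bounds nodal values from above through the
  average.\<close>

lemma node_deviation_le:
  assumes v: "degree (v i) \<le> k" and r: "r \<in> {1..k+1}"
  shows "gl_weight k r * (poly (v i) (gl_node k xf i r) - node_min k xf v i)
    \<le> 2 * (cell_average xf v i - node_min k xf v i)"
  unfolding sum_gl_weight_deviation[of v, OF v, symmetric]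
  using r node_min_le gl_weight_pos[OF k]
  by (intro member_le_sum mult_nonneg_nonneg) (auto intro: less_imp_le)

lemma node_min_le_average:
  assumes v: "degree (v i) \<le> k"
  shows "node_min k xf v i \<le> cell_average xf v i"
proof -
  have "0 \<le> gl_weight k 1 * (poly (v i) (gl_node k xf i 1) - node_min k xf v i)"
    using node_min_le[of 1 v] gl_weight_pos[OF k, of 1] by (intro mult_nonneg_nonneg) auto
  then show ?thesis using node_deviation_le[of v 1, OF v] by simp
qed

text \<open>Pulled back to \<open>[-1, 1]\<close>, the polynomial is expanded in the Lagrange basis.
  Since \<open>\<Lambda>\<close> bounds the Lebesgue function of the reference nodes, the same value
  works for every cell.\<close>

lemma poly_in_cell_le_nodes:
  assumes p: "degree p \<le> k" and x: "x \<in> {xf (i - 1)..xf i}"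
    and M: "\<And>r. r \<in> {1..k+1} \<Longrightarrow> \<bar>poly p (gl_node k xf i r)\<bar> \<le> M"
    and L: "\<And>y. y \<in> {-1..1} \<Longrightarrow> (\<Sum>r=1..k+1. \<bar>poly (lagrange_basis k (gl_point k) r) y\<bar>) \<le> \<Lambda>"
  shows "\<bar>poly p x\<bar> \<le> M * \<Lambda>"
proof -
  have h: "0 < cell_size xf i" using cell by (simp add: cell_size_def)
  define y where "y = (2 * x - xf (i - 1) - xf i) / cell_size xf i"
  have y: "y \<in> {-1..1}" using x h by (auto simp: y_def field_simps cell_size_def)
  have xy: "x = poly to_cell y" using h by (simp add: y_def to_cell_def field_simps)
  have M0: "0 \<le> M" using M[of 1] by (intro order_trans[OF abs_ge_zero]) auto
  have "poly p x = poly (pcompose p to_cell) y" by (simp add: xy poly_pcompose)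
  also have "\<dots> = (\<Sum>r=1..k+1. poly p (gl_node k xf i r) * poly (lagrange_basis k (gl_point k) r) y)"
    by (subst poly_eq_lagrange[OF gl_point_inj[OF k] degree_pcompose_to_cell[OF p]])
      (simp only: poly_sum poly_smult poly_pcompose poly_to_cell_gl_point)
  also have "\<bar>\<dots>\<bar> \<le> (\<Sum>r=1..k+1. \<bar>poly p (gl_node k xf i r) * poly (lagrange_basis k (gl_point k) r) y\<bar>)"
    by (rule sum_abs)
  also have "\<dots> \<le> (\<Sum>r=1..k+1. M * \<bar>poly (lagrange_basis k (gl_point k) r) y\<bar>)"
    unfolding abs_mult using M by (intro sum_mono mult_right_mono) auto
  also have "\<dots> \<le> M * \<Lambda>"
    unfolding sum_distrib_left[symmetric] using L[OF y] M0 by (intro mult_left_mono)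
  finally show ?thesis .
qed

section \<open>The scaling limiter on one cell\<close>

lemma limiter_theta_bounds:
  assumes "degree (v i) \<le> k" "0 \<le> cell_average xf v i"
  shows "0 \<le> limiter_theta k xf v i" "limiter_theta k xf v i \<le> 1"
  using assms node_min_le_average[of v] by (auto simp: limiter_theta_def)

text \<open>Let \<open>a\<close> be the average and \<open>m\<close> the nodal minimum. If
  \<open>m\<close> is non-negative, then \<theta> is 1; otherwise \<theta> is
  \<open>a / (a - m)\<close> and the product is \<open>- m\<close>. In the convention case
  \<open>a = m\<close>, non-negativity of \<open>a\<close> makes both sides zero.\<close>

lemma limiter_theta_gap:
  assumes v: "degree (v i) \<le> k" and avg: "0 \<le> cell_average xf v i"
  shows "(1 - limiter_theta k xf v i) * (cell_average xf v i - node_min k xf v i)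
    = max 0 (- node_min k xf v i)"
proof (cases "cell_average xf v i = node_min k xf v i")
  case True
  then show ?thesis using avg by (simp add: limiter_theta_def)
next
  case False
  let ?a = "cell_average xf v i" and ?m = "node_min k xf v i"
  have lt: "?m < ?a" using node_min_le_average[of v, OF v] False by simp
  show ?thesis
  proof (cases "0 \<le> ?m")
    case True
    then have "1 \<le> ?a / (?a - ?m)" using lt by (simp add: le_divide_eq)
    then show ?thesis using True False by (simp add: limiter_theta_def)
  next
    case m: False
    then have "?a / (?a - ?m) \<le> 1" using lt by (simp add: divide_le_eq)
    then have "limiter_theta k xf v i = ?a / (?a - ?m)" using False by (simp add: limiter_theta_def)
    then show ?thesis using lt m by (simp add: left_diff_distrib)
  qed
qed

text \<open>The limited value grows with the original nodal value, so the minimal node is the worst;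
  there the gap identity yields \<open>m + max 0 (- m)\<close>.\<close>

lemma limited_node_nonneg:
  assumes v: "degree (v i) \<le> k" and avg: "0 \<le> cell_average xf v i" and r: "r \<in> {1..k+1}"
  shows "0 \<le> cell_average xf v i
    + limiter_theta k xf v i * (poly (v i) (gl_node k xf i r) - cell_average xf v i)"
proof -
  let ?a = "cell_average xf v i" and ?m = "node_min k xf v i" and ?t = "limiter_theta k xf v i"
  have "?t * (?m - ?a) \<le> ?t * (poly (v i) (gl_node k xf i r) - ?a)"
    using node_min_le[OF r, of v] limiter_theta_bounds[of v, OF v avg] by (intro mult_left_mono) auto
  moreover have "0 \<le> ?a + ?t * (?m - ?a)"
    using limiter_theta_gap[of v, OF v avg] by (simp add: algebra_simps max_def split: if_splits)
  ultimately show ?thesis by linarith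
qed

text \<open>Prescribed at \<open>k + 1\<close> nodes, the relation holds between polynomials of
  degree at most \<open>k\<close>, so the error formula is valid at every point.\<close>

lemma limited_minus:
  assumes v: "degree (v i) \<le> k" and w: "degree w \<le> k"
    and nodes: "\<And>r. r \<in> {1..k+1} \<Longrightarrow> poly w (gl_node k xf i r) =
      cell_average xf v i + limiter_theta k xf v i * (poly (v i) (gl_node k xf i r) - cell_average xf v i)"
  shows "w - v i = smult (1 - limiter_theta k xf v i) ([:cell_average xf v i:] - v i)"
proof (rule poly_eqI_degree[where A = "gl_node k xf i ` {1..k+1}"])
  fix x assume "x \<in> gl_node k xf i ` {1..k+1}"
  then show "poly (w - v i) x
      = poly (smult (1 - limiter_theta k xf v i) ([:cell_average xf v i:] - v i)) x"
    using nodes by (auto simp: algebra_simps)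
next
  have c: "card (gl_node k xf i ` {1..k+1}) = k + 1" using gl_node_inj by (simp add: card_image)
  show "degree (w - v i) < card (gl_node k xf i ` {1..k+1})"
    using degree_diff_le[OF w v] c by simp
  have "degree ([:cell_average xf v i:] - v i) \<le> k" using v by (intro degree_diff_le) auto
  then show "degree (smult (1 - limiter_theta k xf v i) ([:cell_average xf v i:] - v i))
      < card (gl_node k xf i ` {1..k+1})"
    using c degree_smult_le[of "1 - limiter_theta k xf v i" "[:cell_average xf v i:] - v i"] by simp
qed

text \<open>A nonnegative function cannot approximate v better than the depth of the nodal undershoot of v;
  continuity transfers the deviation at a node on the boundary to the supremum over the open cell.\<close>

lemma undershoot_le_error:
  assumes f: "continuous_on {xf (i - 1)..xf i} f" and f_nonneg: "\<And>y. 0 \<le> f y"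
  shows "max 0 (- node_min k xf v i) \<le> (SUP y\<in>{xf (i - 1)<..<xf i}. \<bar>f y - poly (v i) y\<bar>)"
    (is "_ \<le> ?S")
proof -
  let ?e = "\<lambda>y. \<bar>f y - poly (v i) y\<bar>" and ?I = "{xf (i - 1)<..<xf i}"
  have cl: "closure ?I = {xf (i - 1)..xf i}" using cell by simp
  have cont: "continuous_on (closure ?I) ?e" unfolding cl using f by (intro continuous_intros)
  \<comment> \<open>A real supremum is an upper bound only for a bounded set; compactness of the
    closed cell supplies the bound.\<close>
  have "bdd_above (?e ` closure ?I)"
    unfolding cl using cont[unfolded cl] by (intro bounded_imp_bdd_above compact_imp_bounded compact_continuous_image) auto
  then have "bdd_above (?e ` ?I)" by (rule bdd_above_mono) (use closure_subset in blast)
  then have "?e y \<le> ?S" if "y \<in> ?I" for y by (rule cSUP_upper[OF that])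
  then have S: "?e y \<le> ?S" if "y \<in> closure ?I" for y
    by (rule continuous_le_on_closure[OF cont that])
  obtain r where r: "r \<in> {1..k+1}" "node_min k xf v i = poly (v i) (gl_node k xf i r)"
    using node_min_attained by blast
  have "gl_node k xf i r \<in> closure ?I" using gl_node_in_cell[OF r(1)] unfolding cl .
  \<comment> \<open>At the minimal node the error is at least \<open>f - m\<close>, hence at least
    \<open>- m\<close>, since \<open>f\<close> is non-negative.\<close>
  from S[OF this] show ?thesis using f_nonneg[of "gl_node k xf i r"] r(2) by auto
qed

end

section \<open>An accuracy constant depending only on the degree\<close>

lemma lebesgue_constant:
  "\<exists>\<Lambda>. \<forall>y\<in>{-1..1}. (\<Sum>r=1..k+1. \<bar>poly (lagrange_basis k z r) y\<bar>) \<le> \<Lambda>"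
proof -
  have "continuous_on {-1..1} (\<lambda>y. \<Sum>r=1..k+1. \<bar>poly (lagrange_basis k z r) y\<bar>)"
    by (intro continuous_intros)
  from continuous_attains_sup[OF _ _ this] show ?thesis by auto
qed

text \<open>Mesh, cell, polynomials and comparison function are quantified inside, so that a
  suitable \<open>C\<close> can be chosen from \<open>k\<close> alone.\<close>

definition limiter_error_constant :: "nat \<Rightarrow> real \<Rightarrow> bool" where
  "limiter_error_constant k C \<longleftrightarrow> (\<forall>xf i v w f x.
    xf (i - 1) < xf i \<longrightarrow> degree (v i) \<le> k \<longrightarrow> degree w \<le> k \<longrightarrow> 0 \<le> cell_average xf v i \<longrightarrow>
    (\<forall>r\<in>{1..k+1}. poly w (gl_node k xf i r) = cell_average xf v i
      + limiter_theta k xf v i * (poly (v i) (gl_node k xf i r) - cell_average xf v i)) \<longrightarrow>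
    continuous_on {xf (i - 1)..xf i} f \<longrightarrow> (\<forall>y. 0 \<le> f y) \<longrightarrow> x \<in> {xf (i - 1)..xf i} \<longrightarrow>
    \<bar>poly w x - poly (v i) x\<bar> \<le> C * (SUP y\<in>{xf (i - 1)<..<xf i}. \<bar>f y - poly (v i) y\<bar>))"

lemma limiter_accuracy:
  assumes k: "1 \<le> k"
  shows "\<exists>C. limiter_error_constant k C"
proof -
  obtain \<Lambda> where \<Lambda>: "\<And>y. y \<in> {-1..1} \<Longrightarrow>
      (\<Sum>r=1..k+1. \<bar>poly (lagrange_basis k (gl_point k) r) y\<bar>) \<le> \<Lambda>"
    using lebesgue_constant[of k "gl_point k"] by blast
  \<comment> \<open>\<open>W\<close> dominates every reciprocal weight, turning the weighted nodal
    bound into one uniform in \<open>r\<close>.\<close>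
  define W where "W = (\<Sum>r=1..k+1. 1 / gl_weight k r)"
  \<comment> \<open>The first summand bounds the distance of \<open>v\<close> from its nodal
    minimum, the second the distance of the average from it, both in units of average minus
    minimum.\<close>
  define C where "C = 2 * W * \<Lambda> + 1"
  have \<Lambda>0: "0 \<le> \<Lambda>" by (rule order_trans[OF _ \<Lambda>[of 0]]) (auto intro: sum_nonneg)
  have W: "1 / gl_weight k r \<le> W" if "r \<in> {1..k+1}" for r
    unfolding W_def using that gl_weight_pos[OF k] by (intro member_le_sum) (auto intro: less_imp_le)
  have "0 \<le> W" using W[of 1] gl_weight_pos[OF k, of 1] by (intro order_trans[OF _ W[of 1]]) auto
  then have C0: "0 \<le> C" using \<Lambda>0 by (simp add: C_def)
  have bound: "\<bar>poly w x - poly (v i) x\<bar> \<le> C * (SUP y\<in>{xf (i - 1)<..<xf i}. \<bar>f y - poly (v i) y\<bar>)"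
    if cell: "xf (i - 1) < xf i" and v: "degree (v i) \<le> k" and w: "degree w \<le> k"
      and avg: "0 \<le> cell_average xf v i"
      and nodes: "\<forall>r\<in>{1..k+1}. poly w (gl_node k xf i r) = cell_average xf v i
        + limiter_theta k xf v i * (poly (v i) (gl_node k xf i r) - cell_average xf v i)"
      and f: "continuous_on {xf (i - 1)..xf i} f" "\<forall>y. 0 \<le> f y" and x: "x \<in> {xf (i - 1)..xf i}"
    for xf :: mesh and i v w f x
  proof -
    let ?a = "cell_average xf v i" and ?m = "node_min k xf v i" and ?t = "limiter_theta k xf v i"
    have am: "?m \<le> ?a" by (rule node_min_le_average[where v = v, OF k cell v])
    have "\<bar>poly (v i - [:?m:]) (gl_node k xf i r)\<bar> \<le> 2 * W * (?a - ?m)" if r: "r \<in> {1..k+1}" for r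
    proof -
      let ?d = "poly (v i) (gl_node k xf i r) - ?m"
      have "?d \<le> 1 / gl_weight k r * (2 * (?a - ?m))"
        using node_deviation_le[where v = v, OF k cell v r] gl_weight_pos[OF k r] by (simp add: field_simps)
      also have "\<dots> \<le> W * (2 * (?a - ?m))" using W[OF r] am by (intro mult_right_mono) auto
      also have "\<dots> = 2 * W * (?a - ?m)" by simp
      finally show ?thesis using node_min_le[where v = v and xf = xf and i = i, OF k cell r] by simp
    qed
    moreover have "degree (v i - [:?m:]) \<le> k" using v by (intro degree_diff_le) auto
    ultimately have "\<bar>poly (v i - [:?m:]) x\<bar> \<le> 2 * W * (?a - ?m) * \<Lambda>"
      using \<Lambda> by (intro poly_in_cell_le_nodes[OF k cell _ x]) auto
    \<comment> \<open>Triangle inequality through the nodal minimum.\<close>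
    then have osc: "\<bar>?a - poly (v i) x\<bar> \<le> C * (?a - ?m)"
      using am by (simp add: C_def algebra_simps)
    have "poly w x - poly (v i) x = poly (w - v i) x" by simp
    also have "\<dots> = (1 - ?t) * (?a - poly (v i) x)"
      using nodes by (subst limited_minus[where v = v, OF k cell v w]) auto
    also have "\<bar>\<dots>\<bar> = (1 - ?t) * \<bar>?a - poly (v i) x\<bar>"
      using limiter_theta_bounds(2)[where v = v, OF k cell v avg] by (simp add: abs_mult)
    also have "\<dots> \<le> (1 - ?t) * (C * (?a - ?m))"
      using osc limiter_theta_bounds(2)[where v = v, OF k cell v avg] by (intro mult_left_mono) auto
    also have "\<dots> = C * max 0 (- ?m)"
      using limiter_theta_gap[where v = v, OF k cell v avg] by (simp add: mult.left_commute)
    also have "\<dots> \<le> C * (SUP y\<in>{xf (i - 1)<..<xf i}. \<bar>f y - poly (v i) y\<bar>)"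
      using undershoot_le_error[where v = v, OF k cell f(1)] f(2) C0 by (intro mult_left_mono) auto
    finally show ?thesis .
  qed
  show ?thesis unfolding limiter_error_constant_def by (intro exI[of _ C] allI impI) (rule bound)
qed

section \<open>Positivity of the cell averages\<close>

lemma is_mesh_cell: "is_mesh N xf c \<Longrightarrow> i \<in> {1..N} \<Longrightarrow> xf (i - 1) < xf i"
  by (simp add: is_mesh_def)

text \<open>Traces are nodal values, also at interface \<open>N\<close>, which wraps to cell 1. Thus
  hypotheses imposed only at nodes apply to both sides of every interface.\<close>

lemma right_trace_cell:
  assumes "1 \<le> k" "is_mesh N xf c" "j \<le> N"
  obtains i where "i \<in> {1..N}" "j < N \<Longrightarrow> i = j + 1"
    "\<And>v. right_trace N xf v j = v i (gl_node k xf i 1)"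
proof (cases "j = N")
  case True
  have "1 \<le> N" using assms(2) by (simp add: is_mesh_def)
  then have "xf 0 < xf 1" using is_mesh_cell[OF assms(2), of 1] by simp
  then have "gl_node k xf 1 1 = xf 0" using gl_node_endpoints(1)[of k xf 1] assms(1) by simp
  then show thesis using that[of 1] True \<open>1 \<le> N\<close> by (simp add: right_trace_def)
next
  case False
  then have "xf j < xf (j + 1)" using is_mesh_cell[OF assms(2), of "j + 1"] assms(3) by simp
  then have "gl_node k xf (j + 1) 1 = xf j" using gl_node_endpoints(1)[of k xf "j + 1"] assms(1) by simp
  then show thesis using that[of "j + 1"] False assms(3) by (simp add: right_trace_def)
qed

lemma left_trace_cell:
  assumes "1 \<le> k" "is_mesh N xf c" "j \<le> N"
  obtains i where "i \<in> {1..N}" "0 < j \<Longrightarrow> i = j"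
    "\<And>v. left_trace N xf v j = v i (gl_node k xf i (k + 1))"
proof -
  define i where "i = (if j = 0 then N else j)"
  have i: "i \<in> {1..N}" using assms(2,3) by (auto simp: i_def is_mesh_def)
  then have "xf (i - 1) < xf i" by (rule is_mesh_cell[OF assms(2)])
  then have "gl_node k xf i (k + 1) = xf i" using gl_node_endpoints(2)[of k xf i] assms(1) by simp
  then show thesis using that[of i] i by (simp add: left_trace_def i_def)
qed

lemma abs_le_linf_norm: "l \<in> {1..m} \<Longrightarrow> \<bar>z l\<bar> \<le> linf_norm m z"
  unfolding linf_norm_def by (rule Max_ge) auto

text \<open>\<alpha> bounds every component on either side in absolute value. These quantities are
  the denominators in \<open>cfl_bound\<close> and, halved, the coefficients of the split
  flux.\<close>

lemma trace_le_lf_alpha: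
  assumes "l \<in> {1..m}"
  shows "0 \<le> lf_alpha N m xf G \<rho> u j + right_trace N xf (v_h m G \<rho> u) j l"
    and "0 \<le> lf_alpha N m xf G \<rho> u j - left_trace N xf (v_h m G \<rho> u) j l"
  using abs_le_linf_norm[OF assms, of "right_trace N xf (v_h m G \<rho> u) j"]
    abs_le_linf_norm[OF assms, of "left_trace N xf (v_h m G \<rho> u) j"]
  by (auto simp: lf_alpha_def)

text \<open>The factorization \<open>F = diag(\<rho>) G\<close> lets the Lax--Friedrichs penalty split the flux into an outgoing
  and an incoming part, each a non-negative multiple of a one-sided value of \<open>\<rho>\<close>.\<close>

lemma lf_flux_split:
  assumes k: "1 \<le> k" and mesh: "is_mesh N xf c" and j: "j \<le> N" and l: "l \<in> {1..m}"
    and data: "gradient_flow_data m U S e F G"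
    and S: "\<forall>i\<in>{1..N}. \<forall>r\<in>{1..k+1}. dg_val m \<rho> i (gl_node k xf i r) \<in> S"
  shows "lf_flux N m xf F G \<rho> u j l =
      (lf_alpha N m xf G \<rho> u j + right_trace N xf (v_h m G \<rho> u) j l) / 2
        * right_trace N xf (dg_val m \<rho>) j l
    - (lf_alpha N m xf G \<rho> u j - left_trace N xf (v_h m G \<rho> u) j l) / 2
        * left_trace N xf (dg_val m \<rho>) j l"
proof -
  \<comment> \<open>The factorization is assumed only for states in \<open>S\<close>, which is known
    at nodes; this is why the traces are rewritten as nodal values below.\<close>
  have Fu: "Fu_h m F \<rho> u i (gl_node k xf i r) l
      = dg_val m \<rho> i (gl_node k xf i r) l * v_h m G \<rho> u i (gl_node k xf i r) l"
    if "i \<in> {1..N}" "r \<in> {1..k+1}" for i r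
    using data S that l
    by (simp add: gradient_flow_data_def Fu_h_def v_h_def mat_vec_def sum_distrib_left mult.assoc)
  obtain i where i: "i \<in> {1..N}" "\<And>v. right_trace N xf v j = v i (gl_node k xf i 1)"
    using right_trace_cell[OF k mesh j] by metis
  obtain i' where i': "i' \<in> {1..N}" "\<And>v. left_trace N xf v j = v i' (gl_node k xf i' (k + 1))"
    using left_trace_cell[OF k mesh j] by metis
  have R: "right_trace N xf (Fu_h m F \<rho> u) j l
      = right_trace N xf (dg_val m \<rho>) j l * right_trace N xf (v_h m G \<rho> u) j l"
    unfolding i(2) using i(1) by (intro Fu) auto
  have L: "left_trace N xf (Fu_h m F \<rho> u) j l
      = left_trace N xf (dg_val m \<rho>) j l * left_trace N xf (v_h m G \<rho> u) j l"
    unfolding i'(2) using i'(1) by (intro Fu) auto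
  show ?thesis
    unfolding lf_flux_def face_mean_def face_jump_def R L by (simp add: field_simps)
qed

text \<open>Obtained by testing (E) with the indicator of cell i in component l.\<close>

lemma euler_average:
  assumes k: "1 \<le> k" and mesh: "is_mesh N xf c" and i: "i \<in> {1..N}" and l: "l \<in> {1..m}"
    and euler: "euler_eq N k m xf F G \<tau> \<rho> u \<rho>pre" and \<rho>: "\<rho> \<in> dg_vspace N m k"
  shows "cell_size xf i * (cell_average xf (\<lambda>i. \<rho>pre i l) i - cell_average xf (\<lambda>i. \<rho> i l) i) / \<tau>
    = lf_flux N m xf F G \<rho> u i l - lf_flux N m xf F G \<rho> u (i - 1) l"
proof -
  define \<phi> :: dg_vec where "\<phi> = (\<lambda>i' l'. if i' = i \<and> l' = l then 1 else 0)"
  have cell: "xf (i - 1) < xf i" by (rule is_mesh_cell[OF mesh i])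
  have \<phi>: "\<phi> \<in> dg_vspace N m k" by (auto simp: \<phi>_def dg_vspace_def dg_space_def)
  have val: "dg_val m \<phi> i x l' = (if l' = l then 1 else 0)" if "l' \<in> {1..m}" for x l'
    using that by (simp add: dg_val_def \<phi>_def)
  have pick: "(\<Sum>l'=1..m. g l' * (if l' = l then 1 else 0)) = g l" for g :: "nat \<Rightarrow> real"
    using l by (simp add: if_distrib cong: if_cong)
  \<comment> \<open>On cell \<open>i\<close> the test function is constant in each component and
    equals its interpolant, so the volume term of (E) vanishes.\<close>
  have "interpolant k (gl_node k xf i) (\<lambda>y. dg_val m \<phi> i y l') = [:if l' = l then 1 else 0:]"
    if "l' \<in> {1..m}" for l'
    using that by (intro interpolant_eq gl_node_inj k cell) (auto simp: val)
  then have deriv: "gl_quad_deriv k m xf i (Fu_h m F \<rho> u) (dg_val m \<phi>) = 0"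
    unfolding gl_quad_deriv_def by (simp add: pderiv_pCons)
  have quad: "gl_quad k m xf i (\<lambda>i x l. (dg_val m \<rho>pre i x l - dg_val m \<rho> i x l) / \<tau>) (dg_val m \<phi>)
      = cell_size xf i / 2 * (\<Sum>r=1..k+1. gl_weight k r *
          ((poly (\<rho>pre i l) (gl_node k xf i r) - poly (\<rho> i l) (gl_node k xf i r)) / \<tau>))"
  proof -
    have "(\<Sum>l'=1..m. (dg_val m \<rho>pre i x l' - dg_val m \<rho> i x l') / \<tau> * dg_val m \<phi> i x l')
        = (poly (\<rho>pre i l) x - poly (\<rho> i l) x) / \<tau>" for x
    proof -
      have "(\<Sum>l'=1..m. (dg_val m \<rho>pre i x l' - dg_val m \<rho> i x l') / \<tau> * dg_val m \<phi> i x l')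
          = (\<Sum>l'=1..m. (dg_val m \<rho>pre i x l' - dg_val m \<rho> i x l') / \<tau> * (if l' = l then 1 else 0))"
        by (intro sum.cong refl) (simp add: val)
      also have "\<dots> = (dg_val m \<rho>pre i x l - dg_val m \<rho> i x l) / \<tau>" by (rule pick)
      finally show ?thesis using l by (simp add: dg_val_def)
    qed
    then show ?thesis unfolding gl_quad_def by (simp only:)
  qed
  \<comment> \<open>Here \<open>i\<close> is at least 1 and \<open>i - 1\<close> is less than
    \<open>N\<close>, so neither trace of the test function uses the periodic wrap, even when
    \<open>N = 1\<close>.\<close>
  have "left_trace N xf (dg_val m \<phi>) i = dg_val m \<phi> i (xf i)"
    using i by (simp add: left_trace_def)
  then have left: "(\<Sum>l'=1..m. lf_flux N m xf F G \<rho> u i l' * left_trace N xf (dg_val m \<phi>) i l')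
      = lf_flux N m xf F G \<rho> u i l"
    by (subst pick[symmetric]) (intro sum.cong refl, simp add: val)
  have "right_trace N xf (dg_val m \<phi>) (i - 1) = dg_val m \<phi> i (xf (i - 1))"
    using i by (auto simp: right_trace_def)
  then have right: "(\<Sum>l'=1..m. lf_flux N m xf F G \<rho> u (i - 1) l' * right_trace N xf (dg_val m \<phi>) (i - 1) l')
      = lf_flux N m xf F G \<rho> u (i - 1) l"
    by (subst pick[symmetric]) (intro sum.cong refl, simp add: val)
  have deg: "degree (\<rho>pre i l) \<le> k" "degree (\<rho> i l) \<le> k"
    using euler \<rho> i l by (auto simp: euler_eq_def dg_vspace_def dg_space_def)
  have "(\<Sum>r=1..k+1. gl_weight k r *
        ((poly (\<rho>pre i l) (gl_node k xf i r) - poly (\<rho> i l) (gl_node k xf i r)) / \<tau>))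
      = (2 * cell_average xf (\<lambda>i. \<rho>pre i l) i - 2 * cell_average xf (\<lambda>i. \<rho> i l) i) / \<tau>"
    using cell_average_quadrature[of k xf i "\<lambda>i. \<rho>pre i l", OF k cell deg(1)]
      cell_average_quadrature[of k xf i "\<lambda>i. \<rho> i l", OF k cell deg(2)]
    by (simp only: sum_subtractf[symmetric] right_diff_distrib[symmetric] times_divide_eq_right
        sum_divide_distrib[symmetric])
  moreover have "gl_quad k m xf i (\<lambda>i x l. (dg_val m \<rho>pre i x l - dg_val m \<rho> i x l) / \<tau>) (dg_val m \<phi>)
      = lf_flux N m xf F G \<rho> u i l - lf_flux N m xf F G \<rho> u (i - 1) l"
  proof -
    have "gl_quad k m xf i (\<lambda>i x l. (dg_val m \<rho>pre i x l - dg_val m \<rho> i x l) / \<tau>) (dg_val m \<phi>) =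
        - gl_quad_deriv k m xf i (Fu_h m F \<rho> u) (dg_val m \<phi>)
        + (\<Sum>l=1..m. lf_flux N m xf F G \<rho> u i l * left_trace N xf (dg_val m \<phi>) i l)
        - (\<Sum>l=1..m. lf_flux N m xf F G \<rho> u (i - 1) l * right_trace N xf (dg_val m \<phi>) (i - 1) l)"
      using euler \<phi> i unfolding euler_eq_def by blast
    then show ?thesis by (simp only: deriv left right minus_zero add_0)
  qed
  ultimately show ?thesis
    unfolding quad by (simp add: right_diff_distrib diff_divide_distrib)
qed

section \<open>The time step restriction and non-negative averages\<close>

text \<open>For \<open>b = 0\<close> the conclusion reads \<open>0 \<le> a\<close>, in accordance
  with an infinite quotient. The division-free form spares later case distinctions.\<close>

lemma ereal_le_divide_imp_mult_le:
  assumes "ereal t \<le> ereal a / ereal b" "0 \<le> a" "0 \<le> b"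
  shows "t * b \<le> a"
proof (cases "b = 0")
  case False
  then have "t \<le> a / b" using assms by (simp add: ereal_divide)
  then show ?thesis using False assms(3) by (simp add: pos_le_divide_eq)
qed (use assms in simp)

lemma cfl_bound_cell:
  assumes k: "1 \<le> k" and mesh: "is_mesh N xf c" and i: "i \<in> {1..N}" and l: "l \<in> {1..m}"
    and cfl: "ereal \<tau> \<le> cfl_bound N k m xf G \<rho> u l"
  shows "\<tau> * (lf_alpha N m xf G \<rho> u (i - 1) + right_trace N xf (v_h m G \<rho> u) (i - 1) l)
      \<le> gl_weight k 1 * cell_size xf i"
    and "\<tau> * (lf_alpha N m xf G \<rho> u i - left_trace N xf (v_h m G \<rho> u) i l)
      \<le> gl_weight k (k + 1) * cell_size xf i"
proof -
  have h: "0 \<le> cell_size xf i" using is_mesh_cell[OF mesh i] by (simp add: cell_size_def)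
  have w: "0 \<le> gl_weight k 1" "0 \<le> gl_weight k (k + 1)"
    using gl_weight_pos[OF k] by (auto intro: less_imp_le)
  have "ereal \<tau> \<le> min
        (ereal (gl_weight k 1 * cell_size xf i)
           / ereal (lf_alpha N m xf G \<rho> u (i - 1) + right_trace N xf (v_h m G \<rho> u) (i - 1) l))
        (ereal (gl_weight k (k + 1) * cell_size xf i)
           / ereal (lf_alpha N m xf G \<rho> u i - left_trace N xf (v_h m G \<rho> u) i l))"
    using cfl unfolding cfl_bound_def by (rule order_trans) (use i in \<open>intro Min_le; blast\<close>)
  then have bound: "ereal \<tau> \<le> ereal (gl_weight k 1 * cell_size xf i)
        / ereal (lf_alpha N m xf G \<rho> u (i - 1) + right_trace N xf (v_h m G \<rho> u) (i - 1) l)"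
      "ereal \<tau> \<le> ereal (gl_weight k (k + 1) * cell_size xf i)
        / ereal (lf_alpha N m xf G \<rho> u i - left_trace N xf (v_h m G \<rho> u) i l)"
    by (simp_all only: min.bounded_iff)
  show "\<tau> * (lf_alpha N m xf G \<rho> u (i - 1) + right_trace N xf (v_h m G \<rho> u) (i - 1) l)
      \<le> gl_weight k 1 * cell_size xf i"
    and "\<tau> * (lf_alpha N m xf G \<rho> u i - left_trace N xf (v_h m G \<rho> u) i l)
      \<le> gl_weight k (k + 1) * cell_size xf i"
    by (intro ereal_le_divide_imp_mult_le bound trace_le_lf_alpha[OF l] mult_nonneg_nonneg h w)+
qed

lemma euler_average_nonneg:
  assumes k: "1 \<le> k" and mesh: "is_mesh N xf c" and i: "i \<in> {1..N}" and l: "l \<in> {1..m}"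
    and data: "gradient_flow_data m U S e F G"
    and step: "euler_step N k m xf S e F G \<tau> \<rho> u \<rho>pre"
    and nonneg: "\<forall>i\<in>{1..N}. \<forall>r\<in>{1..k+1}. 0 \<le> poly (\<rho> i l) (gl_node k xf i r)"
    and cfl: "ereal \<tau> \<le> cfl_bound N k m xf G \<rho> u l"
  shows "0 \<le> cell_average xf (\<lambda>i. \<rho>pre i l) i"
proof -
  define R where "R j = right_trace N xf (dg_val m \<rho>) j l" for j
  define L where "L j = left_trace N xf (dg_val m \<rho>) j l" for j
  define a where "a j = lf_alpha N m xf G \<rho> u j + right_trace N xf (v_h m G \<rho> u) j l" for j
  define b where "b j = lf_alpha N m xf G \<rho> u j - left_trace N xf (v_h m G \<rho> u) j l" for j
  let ?h = "cell_size xf i" and ?x = "gl_node k xf i"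
  have cell: "xf (i - 1) < xf i" by (rule is_mesh_cell[OF mesh i])
  then have h: "0 < ?h" by (simp add: cell_size_def)
  have \<tau>: "0 < \<tau>" and \<rho>: "\<rho> \<in> dg_vspace N m k" and euler: "euler_eq N k m xf F G \<tau> \<rho> u \<rho>pre"
    and S: "\<forall>i\<in>{1..N}. \<forall>r\<in>{1..k+1}. dg_val m \<rho> i (gl_node k xf i r) \<in> S"
    using step by (auto simp: euler_step_def)
  have R0: "0 \<le> R j" if "j \<le> N" for j
    by (rule right_trace_cell[OF k mesh that]) (use nonneg l in \<open>auto simp: R_def dg_val_def\<close>)
  have L0: "0 \<le> L j" if "j \<le> N" for j
    by (rule left_trace_cell[OF k mesh that]) (use nonneg l in \<open>auto simp: L_def dg_val_def\<close>)
  have ab: "0 \<le> a j" "0 \<le> b j" for j by (simp_all only: a_def b_def trace_le_lf_alpha[OF l])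
  have flux: "lf_flux N m xf F G \<rho> u j l = a j / 2 * R j - b j / 2 * L j" if "j \<le> N" for j
    unfolding a_def b_def R_def L_def by (rule lf_flux_split[OF k mesh that l data S])
  have Ri: "R (i - 1) = poly (\<rho> i l) (?x 1)"
    using i l gl_node_endpoints(1)[OF k cell] by (auto simp: R_def right_trace_def dg_val_def)
  have Li: "L i = poly (\<rho> i l) (?x (k + 1))"
    using i l gl_node_endpoints(2)[OF k cell] by (auto simp: L_def left_trace_def dg_val_def)
  have deg: "degree (\<rho> i l) \<le> k" using \<rho> i l by (auto simp: dg_vspace_def dg_space_def)
  \<comment> \<open>Only the two endpoint terms of the old average are kept; the interior ones are
    non-negative. They are distinct because \<open>k \<ge> 1\<close>.\<close>
  have "gl_weight k 1 * R (i - 1) + gl_weight k (k + 1) * L i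
      = (\<Sum>r\<in>{1, k + 1}. gl_weight k r * poly (\<rho> i l) (?x r))"
    unfolding Ri Li using k by simp
  also have "\<dots> \<le> (\<Sum>r=1..k+1. gl_weight k r * poly (\<rho> i l) (?x r))"
    using nonneg i gl_weight_pos[OF k] by (intro sum_mono2 mult_nonneg_nonneg) (auto intro: less_imp_le)
  also have "\<dots> = 2 * cell_average xf (\<lambda>i. \<rho> i l) i"
    using cell_average_quadrature[of k xf i "\<lambda>i. \<rho> i l", OF k cell deg] by simp
  finally have "?h * (gl_weight k 1 * R (i - 1) + gl_weight k (k + 1) * L i)
      \<le> ?h * (2 * cell_average xf (\<lambda>i. \<rho> i l) i)"
    using h by (intro mult_left_mono) auto
  \<comment> \<open>The outflow carries values from cell \<open>i\<close> itself, so the endpoint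
    terms just isolated absorb it.\<close>
  moreover have "\<tau> * a (i - 1) * R (i - 1) \<le> gl_weight k 1 * ?h * R (i - 1)"
    "\<tau> * b i * L i \<le> gl_weight k (k + 1) * ?h * L i"
    using cfl_bound_cell[OF k mesh i l cfl] R0[of "i - 1"] L0[of i] i
    by (auto simp: a_def b_def intro!: mult_right_mono)
  \<comment> \<open>The inflow carries values from the neighbouring cells and only increases the
    average.\<close>
  moreover have "0 \<le> \<tau> * a i * R i" "0 \<le> \<tau> * b (i - 1) * L (i - 1)"
    using \<tau> ab R0[of i] L0[of "i - 1"] i by auto
  moreover have "2 * (?h * cell_average xf (\<lambda>i. \<rho>pre i l) i) = ?h * (2 * cell_average xf (\<lambda>i. \<rho> i l) i)
      + \<tau> * a i * R i - \<tau> * b i * L i - \<tau> * a (i - 1) * R (i - 1) + \<tau> * b (i - 1) * L (i - 1)"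
  proof -
    have "?h * (cell_average xf (\<lambda>i. \<rho>pre i l) i - cell_average xf (\<lambda>i. \<rho> i l) i)
        = \<tau> * ((a i / 2 * R i - b i / 2 * L i) - (a (i - 1) / 2 * R (i - 1) - b (i - 1) / 2 * L (i - 1)))"
    proof -
      have le: "i \<le> N" "i - 1 \<le> N" using i by auto
      show ?thesis
        using euler_average[OF k mesh i l euler \<rho>] \<tau> unfolding flux[OF le(1)] flux[OF le(2)]
        by (simp add: nonzero_divide_eq_eq mult.commute)
    qed
    then show ?thesis by (simp add: algebra_simps)
  qed
  ultimately have "0 \<le> 2 * (?h * cell_average xf (\<lambda>i. \<rho>pre i l) i)"
    by (simp add: algebra_simps)
  then show ?thesis using h by (simp add: zero_le_mult_iff)
qed

theorem theorem2p2:
  fixes k :: nat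
  assumes "1 \<le> k"
  shows "\<exists>C :: real.
    \<forall>(m :: nat) (U :: rvec set) (S :: rvec set) (e :: rvec \<Rightarrow> real) (F :: rvec \<Rightarrow> rmat) (G :: rvec \<Rightarrow> rmat)
      (N :: nat) (xf :: mesh) (c_mesh :: real) (\<tau> :: real)
      (\<rho>n :: dg_vec) (u :: dg_vec) (\<rho>pre :: dg_vec) (l :: nat).
      l \<in> {1..m} \<longrightarrow>
      gradient_flow_data m U S e F G \<longrightarrow>
      is_mesh N xf c_mesh \<longrightarrow>
      euler_step N k m xf S e F G \<tau> \<rho>n u \<rho>pre \<longrightarrow>
      (\<forall>i\<in>{1..N}. \<forall>r\<in>{1..k+1}. 0 \<le> poly (\<rho>n i l) (gl_node k xf i r)) \<longrightarrow>
      ereal \<tau> \<le> cfl_bound N k m xf G \<rho>n u l \<longrightarrow>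
      (\<forall>i\<in>{1..N}. 0 \<le> cell_average xf (\<lambda>i. \<rho>pre i l) i) \<and>
      (\<forall>\<rho>new :: dg. is_limited N k xf (\<lambda>i. \<rho>pre i l) \<rho>new \<longrightarrow>
         (\<forall>i\<in>{1..N}. \<forall>r\<in>{1..k+1}. 0 \<le> poly (\<rho>new i) (gl_node k xf i r)) \<and>
         (\<forall>(T :: real) (t\<^sub>n :: real) (\<rho> :: real \<Rightarrow> real \<Rightarrow> rvec).
            periodic_solution m S e F (xf 0) (xf N) T \<rho> \<longrightarrow>
            (\<forall>x. \<forall>t\<in>{0..T}. \<forall>j\<in>{1..m}. 0 \<le> \<rho> x t j) \<longrightarrow>
            0 \<le> t\<^sub>n \<longrightarrow> t\<^sub>n + \<tau> \<le> T \<longrightarrow>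
            (\<forall>i\<in>{1..N}. \<forall>x\<in>{xf (i - 1)<..<xf i}.
               \<bar>poly (\<rho>new i) x - poly (\<rho>pre i l) x\<bar>
                 \<le> C * (SUP y\<in>{xf (i - 1)<..<xf i}. \<bar>\<rho> y (t\<^sub>n + \<tau>) l - poly (\<rho>pre i l) y\<bar>))))"
proof -
  note k = assms
  \<comment> \<open>\<open>C\<close> is fixed before \<open>m\<close>, the mesh and the data are
    introduced, hence depends only on \<open>k\<close>.\<close>
  obtain C where C: "limiter_error_constant k C" using limiter_accuracy[OF k] by blast
  show ?thesis
  proof (intro exI[of _ C] allI impI)
    fix m U S e F G N xf c_mesh \<tau> \<rho>n u \<rho>pre l
    assume l: "l \<in> {1..m}" and data: "gradient_flow_data m U S e F G" and mesh: "is_mesh N xf c_mesh"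
      and step: "euler_step N k m xf S e F G \<tau> \<rho>n u \<rho>pre"
      and nonneg: "\<forall>i\<in>{1..N}. \<forall>r\<in>{1..k+1}. 0 \<le> poly (\<rho>n i l) (gl_node k xf i r)"
      and cfl: "ereal \<tau> \<le> cfl_bound N k m xf G \<rho>n u l"
    let ?v = "\<lambda>i. \<rho>pre i l"
    have avg: "0 \<le> cell_average xf ?v i" if "i \<in> {1..N}" for i
      by (rule euler_average_nonneg[OF k mesh that l data step nonneg cfl])
    note cell = is_mesh_cell[OF mesh]
    have v: "degree (?v i) \<le> k" if "i \<in> {1..N}" for i
      using step that l by (auto simp: euler_step_def euler_eq_def dg_vspace_def dg_space_def)
    have \<tau>: "0 < \<tau>" using step by (simp add: euler_step_def)
    show "(\<forall>i\<in>{1..N}. 0 \<le> cell_average xf ?v i) \<and>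
      (\<forall>\<rho>new :: dg. is_limited N k xf ?v \<rho>new \<longrightarrow>
         (\<forall>i\<in>{1..N}. \<forall>r\<in>{1..k+1}. 0 \<le> poly (\<rho>new i) (gl_node k xf i r)) \<and>
         (\<forall>T t\<^sub>n \<rho>. periodic_solution m S e F (xf 0) (xf N) T \<rho> \<longrightarrow>
            (\<forall>x. \<forall>t\<in>{0..T}. \<forall>j\<in>{1..m}. 0 \<le> \<rho> x t j) \<longrightarrow>
            0 \<le> t\<^sub>n \<longrightarrow> t\<^sub>n + \<tau> \<le> T \<longrightarrow>
            (\<forall>i\<in>{1..N}. \<forall>x\<in>{xf (i - 1)<..<xf i}.
               \<bar>poly (\<rho>new i) x - poly (\<rho>pre i l) x\<bar>
                 \<le> C * (SUP y\<in>{xf (i - 1)<..<xf i}. \<bar>\<rho> y (t\<^sub>n + \<tau>) l - poly (\<rho>pre i l) y\<bar>))))"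
    proof (intro conjI allI impI ballI)
      fix i assume "i \<in> {1..N}"
      then show "0 \<le> cell_average xf ?v i" by (rule avg)
    next
      fix \<rho>new i r assume lim: "is_limited N k xf ?v \<rho>new" and i: "i \<in> {1..N}" and r: "r \<in> {1..k+1}"
      have "poly (\<rho>new i) (gl_node k xf i r) = cell_average xf ?v i
          + limiter_theta k xf ?v i * (poly (?v i) (gl_node k xf i r) - cell_average xf ?v i)"
        using lim i r by (simp add: is_limited_def)
      also have "0 \<le> \<dots>" by (rule limited_node_nonneg[where v = ?v, OF k cell[OF i] v[OF i] avg[OF i] r])
      finally show "0 \<le> poly (\<rho>new i) (gl_node k xf i r)" .
    next
      fix \<rho>new T t\<^sub>n \<rho> i x
      assume lim: "is_limited N k xf ?v \<rho>new" and sol: "periodic_solution m S e F (xf 0) (xf N) T \<rho>"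
        and \<rho>: "\<forall>x. \<forall>t\<in>{0..T}. \<forall>j\<in>{1..m}. 0 \<le> \<rho> x t j" and t: "0 \<le> t\<^sub>n" "t\<^sub>n + \<tau> \<le> T"
        and i: "i \<in> {1..N}" and x: "x \<in> {xf (i - 1)<..<xf i}"
      \<comment> \<open>The new time may equal \<open>T\<close>: continuity and non-negativity of
        the solution are assumed on the closed time interval.\<close>
      have tT: "t\<^sub>n + \<tau> \<in> {0..T}" using t \<tau> by simp
      have "continuous_on (UNIV \<times> {0..T}) (\<lambda>(x, t). \<rho> x t l)"
        using sol l by (simp add: periodic_solution_def)
      moreover have "continuous_on {xf (i - 1)..xf i} (\<lambda>y. (y, t\<^sub>n + \<tau>))"
        by (intro continuous_intros)
      moreover have "(\<lambda>y. (y, t\<^sub>n + \<tau>)) ` {xf (i - 1)..xf i} \<subseteq> UNIV \<times> {0..T}" using tT by auto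
      ultimately have cont: "continuous_on {xf (i - 1)..xf i} (\<lambda>y. \<rho> y (t\<^sub>n + \<tau>) l)"
        using continuous_on_compose2[of "UNIV \<times> {0..T}" "\<lambda>(x, t). \<rho> x t l"] by force
      have w: "degree (\<rho>new i) \<le> k"
        and nodes: "\<And>r. r \<in> {1..k+1} \<Longrightarrow> poly (\<rho>new i) (gl_node k xf i r) = cell_average xf ?v i
          + limiter_theta k xf ?v i * (poly (?v i) (gl_node k xf i r) - cell_average xf ?v i)"
        using lim i by (auto simp: is_limited_def dg_space_def)
      show "\<bar>poly (\<rho>new i) x - poly (\<rho>pre i l) x\<bar>
          \<le> C * (SUP y\<in>{xf (i - 1)<..<xf i}. \<bar>\<rho> y (t\<^sub>n + \<tau>) l - poly (\<rho>pre i l) y\<bar>)"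
        by (rule C[unfolded limiter_error_constant_def, rule_format, where v = ?v,
              OF cell[OF i] v[OF i] w avg[OF i] nodes cont])
          (use \<rho> l tT x in auto)
    qed
  qed
qed

end
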